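(* Let $\epsilon_i\in\{-1,+1\}$ for $i=1,2,\ldots,n$. Let $w$ be any word in the $n$ letters $$\{\sigma_1^{\epsilon_1},\sigma_2^{\epsilon_2},\ldots,\sigma_n^{\epsilon_n}\},$$ where $\sigma_1,\ldots,\sigma_n$ are the standard generators of the braid group on $n+1$ strands. If $B$ is a knot diagram which is the closure of the $(n+1)$-stranded braid represented by $w$, then $$s(B)=U(B).$$
   Context: Rasmussen invariant: for a diagram $D$ of a knot $K$, consider Lee's filtered chain complex $\mathscr{F}^jC^i(D)$ with complex coefficients, i.e. the perturbed Khovanov complex built from the Frobenius algebra $\mathbb{C}\hookrightarrow \mathbb{C}[x]/(x^2-1)$, where $i$ is the homological grading and $\cdots\subseteq\mathscr{F}^{j+1}C^i\subseteq\mathscr{F}^jC^i\subseteq\cdots$ is the quantum filtration. Its homology is 2-dimensional, supported in $i=0$, and generated by Lee's canonical classes $[\mathfrak{s}_o],[\mathfrak{s}_{\bar o}]$ associated with the orientation $o$ of $D$ and the reverse orientation. Let $s_{\min}(D)$ be the largest $j$ such that $[\mathfrak{s}_o]$ (equivalently $[\mathfrak{s}_{\bar o}]$) lies in $\mathscr{F}^jH^0(D)$. Then $s(D)=s(K)=s_{\min}(D)+1\in 2\mathbb{Z}$. This depends only on $K$, and with this normalization $s(K)=2g^*(K)$ for positive knots, where $g^*$ is the smooth slice genus. Seifert graph: let $O(D)$ be the oriented resolution of $D$ (every crossing is smoothed respecting orientation), a disjoint union of circles. The Seifert graph $T(D)$ has one node for each circle of $O(D)$ and, for each positive (respectively negative)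 crossing of $D$, one edge decorated with $+$ (respectively $-$) joining the two distinct circles on which the smoothed crossing lies. The subgraph $T^-(D)$ (respectively $T^+(D)$) is obtained from $T(D)$ by removing all edges decorated with $+$ (respectively $-$), keeping all nodes. Let $w(D)$ be the writhe of $D$ (number of positive crossings minus number of negative crossings). Define $$U(D)=\#\mathrm{nodes}(T(D))-2\,\#\mathrm{components}(T^-(D))+w(D)+1 .$$ The closure of a braid is oriented so that all strands run in the same direction along the braid. *)

theory Defs
  imports Complex_Main
begin

section \<open>Oriented link diagrams\<close>

text \<open>
  A crossing is drawn with both of its strands pointing upwards.  It has incoming ends
  bottom left and bottom right, outgoing ends top left and top right; the two strands run from
  bottom left to top right and from bottom right to top left.  The crossing is positive iff
  the strand from bottom left to top right is the over-strand.
\<close>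

record 'a crossing =
  positive :: bool
  bot_left :: 'a
  bot_right :: 'a
  top_left :: 'a
  top_right :: 'a

datatype side = Left_Side | Right_Side

text \<open>
  A planar diagram code, in which an arc between two crossings may be subdivided by marked
  points.  The elements of \<open>arcs\<close> are the (sub)arcs; \<open>(e, e') \<in> joins\<close> means that
  the head of \<open>e\<close> is glued to the tail of \<open>e'\<close>.  The pair \<open>outer\<close> names an arc together with a
  side of it (left and right being taken with respect to the orientation) that lies on the
  unbounded region of the plane.  A code of this kind determines a planar diagram if the
  underlying plane graph is connected, as it is for every knot diagram.
\<close>

record 'a diagram =
  arcs :: "'a set"
  joins :: "('a \<times> 'a) set"
  crossings :: "'a crossing list"
  outer :: "'a \<times> side"

definition equiv_closure :: "('b \<times> 'b) set \<Rightarrow> ('b \<times> 'b) set" where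
  "equiv_closure r = (r \<union> r\<inverse>)\<^sup>*"

definition strand_steps :: "'a diagram \<Rightarrow> ('a \<times> 'a) set" where
  "strand_steps D = joins D \<union>
     (\<Union>X\<in>set (crossings D). {(bot_left X, top_right X), (bot_right X, top_left X)})"

definition link_components :: "'a diagram \<Rightarrow> 'a set set" where
  "link_components D = arcs D // equiv_closure (strand_steps D)"

definition is_knot :: "'a diagram \<Rightarrow> bool" where
  "is_knot D \<longleftrightarrow> card (link_components D) = 1"

definition n_plus :: "'a diagram \<Rightarrow> nat" where
  "n_plus D = length (filter positive (crossings D))"

definition n_minus :: "'a diagram \<Rightarrow> nat" where
  "n_minus D = length (filter (\<lambda>X. \<not> positive X) (crossings D))"

definition writhe :: "'a diagram \<Rightarrow> int" where
  "writhe D = int (n_plus D) - int (n_minus D)"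


section \<open>Resolutions\<close>

text \<open>
  A resolution is given by the set of (indices of) crossings that receive the 1-smoothing.
  The 0-smoothing joins the two regions swept out when the over-strand is turned
  counterclockwise onto the under-strand.  Hence the smoothing respecting the orientation is the
  0-smoothing of a positive crossing and the 1-smoothing of a negative crossing.
\<close>

definition smoothing :: "'a crossing \<Rightarrow> bool \<Rightarrow> ('a \<times> 'a) set" where
  "smoothing X one =
     (if positive X \<noteq> one
      then {(bot_left X, top_left X), (bot_right X, top_right X)}
      else {(bot_left X, bot_right X), (top_left X, top_right X)})"

definition circle_steps :: "'a diagram \<Rightarrow> nat set \<Rightarrow> ('a \<times> 'a) set" where
  "circle_steps D R = joins D \<union>
     (\<Union>c<length (crossings D). smoothing (crossings D ! c) (c \<in> R))"

definition circles :: "'a diagram \<Rightarrow> nat set \<Rightarrow> 'a set set" where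
  "circles D R = arcs D // equiv_closure (circle_steps D R)"

definition oriented_resolution :: "'a diagram \<Rightarrow> nat set" where
  "oriented_resolution D = {c. c < length (crossings D) \<and> \<not> positive (crossings D ! c)}"

abbreviation seifert_circles :: "'a diagram \<Rightarrow> 'a set set" where
  "seifert_circles D \<equiv> circles D (oriented_resolution D)"


section \<open>Lee's filtered complex\<close>

text \<open>
  The basis \<open>1, x\<close> of $A = C[x]/(x^2 - 1)$.  The product of two basis elements is a basis
  element; the coproduct of a basis element is the sum of the basis tensors in the given set
  (the counit sends \<open>1\<close> to 0 and \<open>x\<close> to 1).
\<close>

datatype lee_basis = One | X

fun lee_mult :: "lee_basis \<Rightarrow> lee_basis \<Rightarrow> lee_basis" where
  "lee_mult One b = b"
| "lee_mult X One = X"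
| "lee_mult X X = One"

fun lee_comult :: "lee_basis \<Rightarrow> (lee_basis \<times> lee_basis) set" where
  "lee_comult One = {(One, X), (X, One)}"
| "lee_comult X = {(X, X), (One, One)}"

text \<open>
  A basis vector of the complex: a resolution together with the set of those of its circles
  that carry the tensor factor \<open>x\<close>; the other circles carry \<open>1\<close>.  A chain is the function
  giving its coefficients.
\<close>

type_synonym 'a state = "nat set \<times> 'a set set"
type_synonym 'a chain = "'a state \<Rightarrow> complex"

definition states :: "'a diagram \<Rightarrow> 'a state set" where
  "states D = (SIGMA R : Pow {..<length (crossings D)}. Pow (circles D R))"

definition factor :: "'a set set \<Rightarrow> 'a set \<Rightarrow> lee_basis" where
  "factor S C = (if C \<in> S then X else One)"

fun hom_degree :: "'a diagram \<Rightarrow> 'a state \<Rightarrow> int" where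
  "hom_degree D (R, S) = int (card R) - int (n_minus D)"

text \<open>The factor \<open>1\<close> has degree 1 and the factor \<open>x\<close> has degree -1.\<close>

fun quantum_degree :: "'a diagram \<Rightarrow> 'a state \<Rightarrow> int" where
  "quantum_degree D (R, S) =
     int (card (circles D R - S)) - int (card S)
       + int (card R) + int (n_plus D) - 2 * int (n_minus D)"

text \<open>
  \<open>lee_edge D R S R' S'\<close>: the basis tensor \<open>S'\<close> occurs (then with coefficient 1) in the image of
  the basis tensor \<open>S\<close> under the map that merges two circles of \<open>R\<close> into one of \<open>R'\<close> or
  splits one circle of \<open>R\<close> into two of \<open>R'\<close>.
\<close>

definition lee_edge ::
    "'a diagram \<Rightarrow> nat set \<Rightarrow> 'a set set \<Rightarrow> nat set \<Rightarrow> 'a set set \<Rightarrow> bool" where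
  "lee_edge D R S R' S' \<longleftrightarrow>
     (\<forall>C \<in> circles D R \<inter> circles D R'. factor S' C = factor S C) \<and>
     ((\<exists>A B C. A \<noteq> B \<and> circles D R - circles D R' = {A, B} \<and> circles D R' - circles D R = {C} \<and>
        factor S' C = lee_mult (factor S A) (factor S B)) \<or>
      (\<exists>A B C. B \<noteq> C \<and> circles D R - circles D R' = {A} \<and> circles D R' - circles D R = {B, C} \<and>
        (factor S' B, factor S' C) \<in> lee_comult (factor S A)))"

fun lee_coeff :: "'a diagram \<Rightarrow> 'a state \<Rightarrow> 'a state \<Rightarrow> complex" where
  "lee_coeff D (R, S) (R', S') =
     (\<Sum>c \<in> {..<length (crossings D)} - R.
        if R' = insert c R \<and> lee_edge D R S R' S' then (- 1) ^ card {k \<in> R. k < c} else 0)"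

definition lee_d :: "'a diagram \<Rightarrow> 'a chain \<Rightarrow> 'a chain" where
  "lee_d D f = (\<lambda>T. if T \<in> states D then \<Sum>S\<in>states D. lee_coeff D S T * f S else 0)"

definition chains :: "'a diagram \<Rightarrow> int \<Rightarrow> 'a chain set" where
  "chains D i = {f. \<forall>T. f T \<noteq> 0 \<longrightarrow> T \<in> states D \<and> hom_degree D T = i}"

definition filtered_chains :: "'a diagram \<Rightarrow> int \<Rightarrow> int \<Rightarrow> 'a chain set" where
  "filtered_chains D j i = {f \<in> chains D i. \<forall>T. f T \<noteq> 0 \<longrightarrow> j \<le> quantum_degree D T}"

definition homology_class :: "'a diagram \<Rightarrow> int \<Rightarrow> 'a chain \<Rightarrow> 'a chain set" where
  "homology_class D i z = {(\<lambda>T. z T + lee_d D b T) | b. b \<in> chains D (i - 1)}"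

definition filtered_homology :: "'a diagram \<Rightarrow> int \<Rightarrow> int \<Rightarrow> 'a chain set set" where
  "filtered_homology D j i =
     {homology_class D i z | z. z \<in> filtered_chains D j i \<and> lee_d D z = (\<lambda>_. 0)}"


section \<open>Lee's canonical generator and the Rasmussen invariant\<close>

text \<open>
  Two sides of arcs are related by \<open>region_steps\<close> if they visibly lie on the same region of the
  complement of the oriented resolution.  At a crossing these are the region to the left, the
  region to the right, and the region in the middle that reaches from the bottom to the top.
\<close>

definition region_steps :: "'a diagram \<Rightarrow> (('a \<times> side) \<times> ('a \<times> side)) set" where
  "region_steps D =
     {((e, s), (e', s)) | e e' s. (e, e') \<in> joins D} \<union>
     (\<Union>Y\<in>set (crossings D).
        {((bot_left Y, Left_Side), (top_left Y, Left_Side)),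
         ((bot_right Y, Right_Side), (top_right Y, Right_Side)),
         ((bot_left Y, Right_Side), (bot_right Y, Left_Side)),
         ((top_left Y, Right_Side), (top_right Y, Left_Side)),
         ((bot_left Y, Right_Side), (top_left Y, Right_Side))})"

text \<open>
  The circle \<open>C\<close> separates \<open>p\<close> from infinity if there is no path from \<open>p\<close> to the unbounded region
  that stays inside regions or crosses circles other than \<open>C\<close>.
\<close>

definition separates_from_infinity :: "'a diagram \<Rightarrow> 'a set \<Rightarrow> 'a \<times> side \<Rightarrow> bool" where
  "separates_from_infinity D C p \<longleftrightarrow>
     (p, outer D) \<notin> equiv_closure
       (region_steps D \<union> {((e, Left_Side), (e, Right_Side)) | e. e \<in> arcs D - C})"

definition nesting :: "'a diagram \<Rightarrow> 'a set \<Rightarrow> nat" where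
  "nesting D C = card {C' \<in> seifert_circles D - {C}.
     \<exists>e\<in>C. separates_from_infinity D C' (e, Left_Side)}"

text \<open>A circle runs counterclockwise iff its inside lies to its left.\<close>

definition counterclockwise :: "'a diagram \<Rightarrow> 'a set \<Rightarrow> bool" where
  "counterclockwise D C \<longleftrightarrow> (\<exists>e\<in>C. separates_from_infinity D C (e, Left_Side))"

text \<open>
  Lee's generator labels a circle by $a = x + 1$ if the number of circles separating it from
  infinity, plus 1 if it runs counterclockwise, is even, and by $b = x - 1$ otherwise.
\<close>

definition label_a :: "'a diagram \<Rightarrow> 'a set \<Rightarrow> bool" where
  "label_a D C \<longleftrightarrow> even (nesting D C + (if counterclockwise D C then 1 else 0))"

text \<open>
  The expansion of the tensor product of these labels: the coefficient of \<open>x\<close> is 1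
  in both labels, that of \<open>1\<close> is 1 in \<open>a\<close> and -1 in \<open>b\<close>.
\<close>

definition canonical_generator :: "'a diagram \<Rightarrow> 'a chain" where
  "canonical_generator D = (\<lambda>(R, S).
     if (R, S) \<in> states D \<and> R = oriented_resolution D
     then \<Prod>C \<in> seifert_circles D - S. if label_a D C then 1 else - 1
     else 0)"

definition s_min :: "'a diagram \<Rightarrow> int" where
  "s_min D = (GREATEST j.
     homology_class D 0 (canonical_generator D) \<in> filtered_homology D j 0)"

definition rasmussen_s :: "'a diagram \<Rightarrow> int" where
  "rasmussen_s D = s_min D + 1"


section \<open>The Seifert graph and the number U\<close>

text \<open>
  An edge consists of the index of a crossing, its decoration (\<open>True\<close> for +, \<open>False\<close> for -) and
  the set of its end nodes; thanks to the index, multiple edges are kept apart.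
\<close>

record 'v decorated_graph =
  nodes :: "'v set"
  edges :: "(nat \<times> bool \<times> 'v set) set"

definition seifert_graph :: "'a diagram \<Rightarrow> 'a set decorated_graph" where
  "seifert_graph D =
     \<lparr>nodes = seifert_circles D,
      edges = {(c, positive (crossings D ! c),
                {C \<in> seifert_circles D. bot_left (crossings D ! c) \<in> C \<or>
                                        bot_right (crossings D ! c) \<in> C})
               | c. c < length (crossings D)}\<rparr>"

definition remove_positive_edges :: "'v decorated_graph \<Rightarrow> 'v decorated_graph" where
  "remove_positive_edges G = G\<lparr>edges := {(c, p, V) \<in> edges G. \<not> p}\<rparr>"

definition graph_components :: "'v decorated_graph \<Rightarrow> 'v set set" where
  "graph_components G =
     nodes G // equiv_closure {(u, v). \<exists>(c, p, V) \<in> edges G. u \<in> V \<and> v \<in> V}"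

definition U_bound :: "'a diagram \<Rightarrow> int" where
  "U_bound D = int (card (nodes (seifert_graph D)))
     - 2 * int (card (graph_components (remove_positive_edges (seifert_graph D))))
     + writhe D + 1"


section \<open>Closures of braids\<close>

text \<open>
  A letter \<open>(i, e)\<close> with \<open>e = 1\<close> or \<open>e = - 1\<close> stands for the generator $sigma_i^e$, which
  crosses the strands in positions \<open>i\<close> and \<open>i + 1\<close>; $sigma_i$ is a positive crossing.
\<close>

type_synonym braid_word = "(nat \<times> int) list"

text \<open>
  The word is read from bottom to top, all strands pointing upwards.  The arc \<open>(p, t)\<close> is the piece
  in position \<open>p\<close> (counted from the left, starting with 1) between the letters number \<open>t - 1\<close> and
  \<open>t\<close>.  The closing strands run around the right-hand side, so that the unbounded region is to
  the left of position 1.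
\<close>

definition braid_crossing :: "braid_word \<Rightarrow> nat \<Rightarrow> (nat \<times> nat) crossing" where
  "braid_crossing w t = (case w ! t of (i, e) \<Rightarrow>
     \<lparr>positive = (e = 1),
      bot_left = (i, t), bot_right = (i + 1, t),
      top_left = (i, t + 1), top_right = (i + 1, t + 1)\<rparr>)"

definition braid_closure :: "nat \<Rightarrow> braid_word \<Rightarrow> (nat \<times> nat) diagram" where
  "braid_closure k w =
     \<lparr>arcs = {1..k} \<times> {0..length w},
      joins = {((p, t), (p, t + 1)) | p t. p \<in> {1..k} \<and> t < length w \<and>
                 p \<noteq> fst (w ! t) \<and> p \<noteq> fst (w ! t) + 1}
              \<union> {((p, length w), (p, 0)) | p. p \<in> {1..k}},
      crossings = map (braid_crossing w) [0..<length w],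
      outer = ((1, 0), Left_Side)\<rparr>"

end

theory Submission
  imports Defs
begin

text \<open>
  The Seifert circles of the braid closure are the strand positions \<open>1, \<dots>, n + 1\<close>, and Lee's generator
  labels them alternately by $a$ and $b$.

  For the lower bound, cut the positions at the negative columns into blocks.  Reversing all labels of
  the last block gives an exact chain: at the negative column in front of the block the two labels
  agree, so the chain is a coproduct, and at every positive column they differ, so all merges kill it.
  Subtracting this chain from the generator leaves only the basis tensors with an odd number of factors
  \<open>1\<close> in the block.  Repeating this from right to left raises the filtration level by 2 for each
  negative column.

  For the upper bound, cut at the positive columns instead.  The functional that pairs a chain with
  the alternating sign of its \<open>x\<close>-positions, restricted to the basis tensors with an odd number of factors
  \<open>x\<close> in each block, vanishes on boundaries but not on the generator, and only sees degrees up to the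
  required bound.

  Neither argument needs the circles of a resolution with two unoriented crossings: a coefficient of the
  differential does not change when \<open>1\<close> and \<open>x\<close> are exchanged on both of the circles being merged, or
  on both of the circles arising from a split.
\<close>

section \<open>Lee's differential and the toggling of two circles\<close>

lemma finite_circles: "finite (arcs D) \<Longrightarrow> finite (circles D R)"
  by (auto simp: circles_def quotient_def)

lemma finite_states: "finite (arcs D) \<Longrightarrow> finite (states D)"
  by (auto simp: states_def finite_circles intro!: finite_SigmaI)

lemma sym_diff_pair_cancel: "sym_diff (sym_diff S {A, B}) {A, B} = S"
  by auto

text \<open>Toggling membership of \<open>A\<close> and \<open>B\<close> is an involution, and
  reindexing by it turns the sum into its own negative.\<close>

lemma sum_antisymmetric_eq_0:
  fixes g :: "'b set \<Rightarrow> complex"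
  assumes "finite \<S>" "\<And>S. S \<in> \<S> \<Longrightarrow> sym_diff S {A, B} \<in> \<S>"
    and "\<And>S. S \<in> \<S> \<Longrightarrow> g (sym_diff S {A, B}) = - g S"
  shows "(\<Sum>S\<in>\<S>. g S) = 0"
proof -
  have "(\<Sum>S\<in>\<S>. g S) = (\<Sum>S\<in>\<S>. g (sym_diff S {A, B}))"
    by (rule sum.reindex_bij_witness[of _ "\<lambda>S. sym_diff S {A, B}" "\<lambda>S. sym_diff S {A, B}"])
      (use assms(2) in \<open>auto simp only: sym_diff_pair_cancel\<close>)
  also have "\<dots> = - (\<Sum>S\<in>\<S>. g S)"
    by (simp add: assms(3) sum_negf)
  finally show ?thesis by simp
qed

fun swap_basis :: "lee_basis \<Rightarrow> lee_basis" where
  "swap_basis One = X"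
| "swap_basis X = One"

lemma factor_sym_diff:
  "factor (sym_diff S {A, B}) C = (if C = A \<or> C = B then swap_basis (factor S C) else factor S C)"
  by (auto simp: factor_def)

lemma lee_mult_swap [simp]: "lee_mult (swap_basis a) (swap_basis b) = lee_mult a b"
  by (cases a; cases b) auto

lemma lee_comult_swap [simp]: "(swap_basis a, swap_basis b) \<in> lee_comult c \<longleftrightarrow> (a, b) \<in> lee_comult c"
  by (cases a; cases b; cases c) auto

text \<open>Two source circles disappear, so the edge is a merge. Exchanging \<open>1\<close> and
  \<open>x\<close> is multiplication by \<open>x\<close>, and doing it in both factors multiplies
  their product by \<open>x^2 = 1\<close>.\<close>

lemma lee_edge_swap_source:
  assumes "A \<noteq> B" "{A, B} \<subseteq> circles D R - circles D R'" "lee_edge D R S R' S'"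
  shows "lee_edge D R (sym_diff S {A, B}) R' S'"
proof -
  have com: "\<forall>C \<in> circles D R \<inter> circles D R'. factor S' C = factor (sym_diff S {A, B}) C"
    using assms(2,3) unfolding lee_edge_def factor_sym_diff by auto
  have "circles D R - circles D R' \<noteq> {A'}" for A'
    using assms(1,2) by (metis insert_subset singletonD)
  then obtain A' B' C where *: "A' \<noteq> B'" "circles D R - circles D R' = {A', B'}"
    "circles D R' - circles D R = {C}" "factor S' C = lee_mult (factor S A') (factor S B')"
    using assms(3) unfolding lee_edge_def by metis
  have "{A', B'} = {A, B}" using assms(1,2) *(1,2) by auto
  then have "factor S' C
      = lee_mult (factor (sym_diff S {A, B}) A') (factor (sym_diff S {A, B}) B')"
    unfolding factor_sym_diff using *(4) by (auto simp: doubleton_eq_iff)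
  then show ?thesis
    using com *(1-3) unfolding lee_edge_def by metis
qed

text \<open>Two new circles make the edge a split, and multiplying both tensor factors by
  \<open>x\<close> leaves a coproduct unchanged, again because \<open>x^2 = 1\<close>.\<close>

lemma lee_edge_swap_target:
  assumes "A \<noteq> B" "{A, B} \<subseteq> circles D R' - circles D R" "lee_edge D R S R' S'"
  shows "lee_edge D R S R' (sym_diff S' {A, B})"
proof -
  have com: "\<forall>C \<in> circles D R \<inter> circles D R'. factor (sym_diff S' {A, B}) C = factor S C"
    using assms(2,3) unfolding lee_edge_def factor_sym_diff by auto
  have "circles D R' - circles D R \<noteq> {A'}" for A'
    using assms(1,2) by (metis insert_subset singletonD)
  then obtain A' B' C where *: "A' \<noteq> B'" "circles D R' - circles D R = {A', B'}"
    "circles D R - circles D R' = {C}" "(factor S' A', factor S' B') \<in> lee_comult (factor S C)"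
    using assms(3) unfolding lee_edge_def by metis
  have "{A', B'} = {A, B}" using assms(1,2) *(1,2) by auto
  then have "(factor (sym_diff S' {A, B}) A', factor (sym_diff S' {A, B}) B')
      \<in> lee_comult (factor S C)"
    unfolding factor_sym_diff using *(4) by (auto simp: doubleton_eq_iff)
  then show ?thesis
    using com *(1-3) unfolding lee_edge_def by metis
qed

definition edge_sign :: "'a diagram \<Rightarrow> nat set \<Rightarrow> nat set \<Rightarrow> complex" where
  "edge_sign D R R' = (\<Sum>c \<in> {..<length (crossings D)} - R.
     if R' = insert c R then (- 1) ^ card {k \<in> R. k < c} else 0)"

lemma lee_coeff_eq:
  "lee_coeff D (R, S) (R', S') = edge_sign D R R' * (if lee_edge D R S R' S' then 1 else 0)"
  by (auto simp: edge_sign_def intro!: sum.cong)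

lemma edge_sign_nonzeroD:
  assumes "edge_sign D R R' \<noteq> 0"
  shows "\<exists>c<length (crossings D). c \<notin> R \<and> R' = insert c R"
proof (rule ccontr)
  assume "\<not> ?thesis"
  then have "edge_sign D R R' = 0"
    unfolding edge_sign_def by (intro sum.neutral) auto
  with assms show False by simp
qed

lemma edge_sign_insert:
  assumes "c < length (crossings D)" "c \<notin> R"
  shows "edge_sign D R (insert c R) = (- 1) ^ card {k \<in> R. k < c}"
proof -
  have "edge_sign D R (insert c R) = (\<Sum>x \<in> {..<length (crossings D)} - R.
      if x = c then (- 1) ^ card {k \<in> R. k < c} else 0)"
    unfolding edge_sign_def by (rule sum.cong) (use assms in auto)
  then show ?thesis
    using assms by simp
qed

section \<open>Cancellation in the differential and in its transpose\<close>

definition supported_on :: "'a diagram \<Rightarrow> nat set \<Rightarrow> 'a chain \<Rightarrow> bool" where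
  "supported_on D R f \<longleftrightarrow> (\<forall>R' S. f (R', S) \<noteq> 0 \<longrightarrow> R' = R \<and> S \<subseteq> circles D R)"

lemma lee_d_supported_on:
  assumes "finite (arcs D)" "R \<subseteq> {..<length (crossings D)}" "supported_on D R f" "T \<in> states D"
  shows "lee_d D f T = (\<Sum>S\<in>Pow (circles D R). lee_coeff D (R, S) T * f (R, S))"
proof -
  have "lee_d D f T = (\<Sum>S\<in>states D. lee_coeff D S T * f S)"
    using assms by (simp add: lee_d_def)
  also have "\<dots> = (\<Sum>S\<in>Pair R ` Pow (circles D R). lee_coeff D S T * f S)"
  proof (rule sum.mono_neutral_right)
    show "\<forall>S\<in>states D - Pair R ` Pow (circles D R). lee_coeff D S T * f S = 0"
      using assms(3) by (fastforce simp: supported_on_def)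
    show "Pair R ` Pow (circles D R) \<subseteq> states D"
      using assms(2) by (auto simp: states_def)
  qed (simp add: finite_states assms)
  also have "\<dots> = (\<Sum>S\<in>Pow (circles D R). lee_coeff D (R, S) T * f (R, S))"
    by (subst sum.reindex) (auto simp: inj_on_def)
  finally show ?thesis .
qed

text \<open>For a fixed target, the basis tensors mapping to it are closed under toggling
  \<open>A\<close> and \<open>B\<close> and share one sign, so their coefficients cancel in pairs.
  All that has to be known about \<open>R'\<close> is that two circles of \<open>R\<close> are no
  longer circles there.\<close>

lemma lee_d_antisymmetric:
  assumes fin: "finite (arcs D)" and R: "R \<subseteq> {..<length (crossings D)}" and f: "supported_on D R f"
    and AB: "\<And>c. c < length (crossings D) \<Longrightarrow> c \<notin> R \<Longrightarrow> R' = insert c R \<Longrightarrow>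
      \<exists>A B. A \<noteq> B \<and> {A, B} \<subseteq> circles D R - circles D R' \<and>
        (\<forall>S \<subseteq> circles D R. f (R, sym_diff S {A, B}) = - f (R, S))"
  shows "lee_d D f (R', S') = 0"
proof (cases "(R', S') \<in> states D \<and> edge_sign D R R' \<noteq> 0")
  case True
  then obtain A B where AB': "A \<noteq> B" "{A, B} \<subseteq> circles D R - circles D R'"
    and anti: "\<And>S. S \<subseteq> circles D R \<Longrightarrow> f (R, sym_diff S {A, B}) = - f (R, S)"
    using AB edge_sign_nonzeroD[of D R R'] by metis
  let ?\<S> = "{S \<in> Pow (circles D R). lee_edge D R S R' S'}"
  have "lee_d D f (R', S') = (\<Sum>S\<in>Pow (circles D R). lee_coeff D (R, S) (R', S') * f (R, S))"
    using True by (intro lee_d_supported_on fin R f) simp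
  also have "\<dots> = (\<Sum>S\<in>Pow (circles D R).
      edge_sign D R R' * (if lee_edge D R S R' S' then f (R, S) else 0))"
    unfolding lee_coeff_eq by (intro sum.cong) auto
  also have "\<dots> = edge_sign D R R' * (\<Sum>S\<in>?\<S>. f (R, S))"
    by (subst sum.inter_filter) (auto simp: finite_circles fin sum_distrib_left)
  also have "(\<Sum>S\<in>?\<S>. f (R, S)) = 0"
  proof (rule sum_antisymmetric_eq_0)
    show "sym_diff S {A, B} \<in> ?\<S>" if "S \<in> ?\<S>" for S
      using that lee_edge_swap_source[OF AB'] AB'(2) by blast
  qed (use fin anti in \<open>auto simp: finite_circles\<close>)
  finally show ?thesis by simp
next
  case False
  then consider "(R', S') \<notin> states D" | "(R', S') \<in> states D" "edge_sign D R R' = 0" by blast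
  then show ?thesis
  proof cases
    case 1
    then show ?thesis by (simp add: lee_d_def)
  next
    case 2
    then show ?thesis
      using fin R f by (simp add: lee_d_supported_on lee_coeff_eq del: lee_coeff.simps)
  qed
qed

text \<open>The transposed cancellation: for a fixed source, the targets come in pairs with opposite
  values of \<open>\<Phi>\<close>. This produces functionals that kill boundaries.\<close>

lemma pairing_lee_d_antisymmetric:
  fixes \<Phi> :: "'a set set \<Rightarrow> complex"
  assumes fin: "finite (arcs D)" and R': "R' \<subseteq> {..<length (crossings D)}"
    and AB: "\<And>c. c \<in> R' \<Longrightarrow> \<exists>A B. A \<noteq> B \<and> {A, B} \<subseteq> circles D R' - circles D (R' - {c}) \<and>
      (\<forall>S \<subseteq> circles D R'. \<Phi> (sym_diff S {A, B}) = - \<Phi> S)"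
  shows "(\<Sum>S\<in>Pow (circles D R'). \<Phi> S * lee_d D b (R', S)) = 0"
proof -
  have zero: "(\<Sum>S'\<in>Pow (circles D R'). \<Phi> S' * lee_coeff D (R, S) (R', S')) = 0" for R S
  proof (cases "edge_sign D R R' = 0")
    case False
    then obtain c where c: "c \<notin> R" "R' = insert c R"
      using edge_sign_nonzeroD by blast
    then have R: "R' - {c} = R" "c \<in> R'" by auto
    from AB[of c] obtain A B where AB': "A \<noteq> B" "{A, B} \<subseteq> circles D R' - circles D R"
      and anti: "\<And>S. S \<subseteq> circles D R' \<Longrightarrow> \<Phi> (sym_diff S {A, B}) = - \<Phi> S"
      using R by auto
    let ?\<S> = "{S' \<in> Pow (circles D R'). lee_edge D R S R' S'}"
    have "(\<Sum>S'\<in>Pow (circles D R'). \<Phi> S' * lee_coeff D (R, S) (R', S'))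
        = (\<Sum>S'\<in>Pow (circles D R'). edge_sign D R R' * (if lee_edge D R S R' S' then \<Phi> S' else 0))"
      unfolding lee_coeff_eq by (intro sum.cong) auto
    also have "\<dots> = edge_sign D R R' * (\<Sum>S'\<in>?\<S>. \<Phi> S')"
      by (subst sum.inter_filter) (auto simp: finite_circles fin sum_distrib_left)
    also have "(\<Sum>S'\<in>?\<S>. \<Phi> S') = 0"
    proof (rule sum_antisymmetric_eq_0)
      show "sym_diff S {A, B} \<in> ?\<S>" if "S \<in> ?\<S>" for S
        using that lee_edge_swap_target[OF AB'] AB'(2) by blast
    qed (use fin anti in \<open>auto simp: finite_circles\<close>)
    finally show ?thesis by simp
  qed (simp add: lee_coeff_eq del: lee_coeff.simps)
  have "(\<Sum>S\<in>Pow (circles D R'). \<Phi> S * lee_d D b (R', S))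
      = (\<Sum>S\<in>Pow (circles D R'). \<Sum>T\<in>states D. b T * (\<Phi> S * lee_coeff D T (R', S)))"
    using R' by (intro sum.cong) (auto simp: lee_d_def states_def sum_distrib_left mult_ac)
  also have "\<dots> = (\<Sum>T\<in>states D. b T * (\<Sum>S\<in>Pow (circles D R'). \<Phi> S * lee_coeff D T (R', S)))"
    by (subst sum.swap) (simp add: sum_distrib_left)
  also have "\<dots> = 0"
    using zero by (intro sum.neutral) (auto split: prod.splits)
  finally show ?thesis .
qed

section \<open>Linearity of the differential and the relation of being homologous\<close>

lemma lee_d_add: "lee_d D (\<lambda>T. f T + g T) = (\<lambda>T. lee_d D f T + lee_d D g T)"
  by (auto simp: lee_d_def fun_eq_iff distrib_left sum.distrib)

lemma lee_d_uminus: "lee_d D (\<lambda>T. - f T) = (\<lambda>T. - lee_d D f T)"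
  by (auto simp: lee_d_def fun_eq_iff sum_negf)

lemma lee_d_zero [simp]: "lee_d D (\<lambda>_. 0) = (\<lambda>_. 0)"
  by (auto simp: lee_d_def fun_eq_iff)

definition homologous :: "'a diagram \<Rightarrow> int \<Rightarrow> 'a chain \<Rightarrow> 'a chain \<Rightarrow> bool" where
  "homologous D i z z' \<longleftrightarrow> (\<exists>b\<in>chains D (i - 1). z' = (\<lambda>T. z T + lee_d D b T))"

lemma homologous_refl: "homologous D i z z"
  unfolding homologous_def by (rule bexI[of _ "\<lambda>_. 0"]) (auto simp: chains_def)

lemma chains_add: "f \<in> chains D i \<Longrightarrow> g \<in> chains D i \<Longrightarrow> (\<lambda>T. f T + g T) \<in> chains D i"
  unfolding chains_def by (auto, (metis add.right_neutral)+)

lemma chains_uminus: "f \<in> chains D i \<Longrightarrow> (\<lambda>T. - f T) \<in> chains D i"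
  unfolding chains_def by auto

lemma homologous_sym:
  assumes "homologous D i z z'" shows "homologous D i z' z"
proof -
  obtain b where "b \<in> chains D (i - 1)" "z' = (\<lambda>T. z T + lee_d D b T)"
    using assms by (auto simp: homologous_def)
  then show ?thesis
    unfolding homologous_def
    by (intro bexI[of _ "\<lambda>T. - b T"]) (auto simp: lee_d_uminus chains_uminus)
qed

lemma homologous_trans:
  assumes "homologous D i z z'" "homologous D i z' z''" shows "homologous D i z z''"
proof -
  obtain b b' where "b \<in> chains D (i - 1)" "z' = (\<lambda>T. z T + lee_d D b T)"
    "b' \<in> chains D (i - 1)" "z'' = (\<lambda>T. z' T + lee_d D b' T)"
    using assms by (auto simp: homologous_def)
  then show ?thesis
    unfolding homologous_def
    by (intro bexI[of _ "\<lambda>T. b T + b' T"]) (auto simp: lee_d_add chains_add add.assoc)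
qed

lemma mem_homology_class: "z' \<in> homology_class D i z \<longleftrightarrow> homologous D i z z'"
  by (auto simp: homology_class_def homologous_def)

lemma homology_class_eq_iff: "homology_class D i z = homology_class D i z' \<longleftrightarrow> homologous D i z z'"
  using homologous_refl homologous_sym homologous_trans mem_homology_class by blast

section \<open>Sign characters on sets of strand positions\<close>

text \<open>Since \<open>s p\<close> is its own inverse, it is the factor gained when
  \<open>p\<close> enters the set as well as when \<open>p\<close> leaves it.\<close>

lemma prod_sym_diff_pair:
  fixes s :: "nat \<Rightarrow> complex"
  assumes "finite U" "\<And>p. s p * s p = 1" "p \<noteq> q"
  shows "prod s (sym_diff U {p, q}) = s p * s q * prod s U"
proof -
  have single: "prod s (sym_diff W {x}) = s x * prod s W" if "finite W" for W x
  proof (cases "x \<in> W")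
    case True
    then have "sym_diff W {x} = W - {x}" by auto
    moreover have "prod s W = s x * prod s (W - {x})"
      using that True by (rule prod.remove)
    ultimately show ?thesis
      by (simp add: mult.assoc[symmetric] assms(2))
  next
    case False
    then have "sym_diff W {x} = insert x W" by auto
    then show ?thesis using that False by simp
  qed
  have "sym_diff U {p, q} = sym_diff (sym_diff U {p}) {q}"
    using assms(3) by auto
  then have "prod s (sym_diff U {p, q}) = s q * prod s (sym_diff U {p})"
    using single[of "sym_diff U {p}" q] assms(1) by simp
  also have "prod s (sym_diff U {p}) = s p * prod s U"
    by (rule single) fact
  finally show ?thesis by (simp add: mult_ac)
qed

text \<open>
  Cutting the positions between \<open>j\<close> and \<open>j + 1\<close> for every \<open>j \<in> J\<close> leaves blocks of consecutive
  positions; \<open>rank J p\<close> is the number of the block of \<open>p\<close>.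
\<close>

definition rank :: "nat set \<Rightarrow> nat \<Rightarrow> nat" where
  "rank J p = card (J \<inter> {1..<p})"

lemma rank_Suc: "1 \<le> p \<Longrightarrow> rank J (Suc p) = (if p \<in> J then Suc (rank J p) else rank J p)"
  by (simp add: rank_def atLeastLessThanSuc)

lemma rank_1 [simp]: "rank J (Suc 0) = 0"
  by (simp add: rank_def)

lemma rank_image: "rank J ` {1..Suc n} = {0..rank J (Suc n)}"
proof (induction n)
  case (Suc n)
  have "{1..Suc (Suc n)} = insert (Suc (Suc n)) {1..Suc n}" by auto
  then have "rank J ` {1..Suc (Suc n)} = insert (rank J (Suc (Suc n))) {0..rank J (Suc n)}"
    using Suc by simp
  then show ?case
    by (auto simp: rank_Suc)
qed simp

text \<open>A discrete intermediate value argument: the rank starts at 0 and rises only by single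
  jumps at the cuts. It locates the column just in front of block \<open>v\<close>.\<close>

lemma rank_jump:
  assumes "1 \<le> v" "v \<le> rank J (Suc n)"
  obtains i where "i \<in> J" "i \<in> {1..n}" "rank J (Suc i) = v" "rank J i = v - 1"
proof -
  have "\<exists>i\<in>J \<inter> {1..n}. rank J (Suc i) = v \<and> rank J i = v - 1"
    using assms(2)
  proof (induction n)
    case 0
    then show ?case using assms(1) by simp
  next
    case (Suc n)
    show ?case
    proof (cases "v \<le> rank J (Suc n)")
      case True
      then show ?thesis using Suc.IH by fastforce
    next
      case False
      then have "Suc n \<in> J" "v = Suc (rank J (Suc n))"
        using Suc.prems by (auto simp: rank_Suc split: if_splits)
      then show ?thesis by (intro bexI[of _ "Suc n"]) (auto simp: rank_Suc)
    qed
  qed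
  then show ?thesis using that by blast
qed

text \<open>The exponent \<open>Suc p\<close> gives odd positions the sign \<open>+1\<close>: there
  Lee's generator carries \<open>a\<close>, whose coefficient at \<open>1\<close> is
  positive.\<close>

definition alternating_sign :: "nat set \<Rightarrow> complex" where
  "alternating_sign U = (\<Prod>p\<in>U. (- 1) ^ Suc p)"

text \<open>On the positions of the factors \<open>1\<close>, multiplying by this character
  interchanges the labels \<open>a\<close> and \<open>b\<close> throughout block
  \<open>v\<close>.\<close>

definition block_parity :: "nat set \<Rightarrow> nat \<Rightarrow> nat set \<Rightarrow> complex" where
  "block_parity J v U = (\<Prod>p\<in>U. if rank J p = v then - 1 else 1)"

lemma alternating_sign_toggle:
  "finite U \<Longrightarrow> alternating_sign (sym_diff U {i, Suc i}) = - alternating_sign U"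
  unfolding alternating_sign_def
  by (subst prod_sym_diff_pair) (auto simp flip: power_add power_Suc simp del: power_Suc)

lemma alternating_sign_cases: "alternating_sign U = 1 \<or> alternating_sign U = - 1"
  unfolding alternating_sign_def
  by (induction U rule: infinite_finite_induct) (auto simp: uminus_power_if)

lemma block_parity_eq:
  assumes "finite U"
  shows "block_parity J v U = (- 1) ^ card {p \<in> U. rank J p = v}"
proof -
  have "block_parity J v U = (\<Prod>p\<in>{p \<in> U. rank J p = v}. - 1)"
    unfolding block_parity_def by (subst prod.inter_filter) (use assms in auto)
  then show ?thesis by simp
qed

lemma block_parity_toggle_same:
  assumes "finite U" "rank J i = rank J (Suc i)"
  shows "block_parity J v (sym_diff U {i, Suc i}) = block_parity J v U"
  unfolding block_parity_def using assms by (subst prod_sym_diff_pair) auto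

lemma block_parity_toggle_jump:
  assumes "finite U" "i \<in> J" "1 \<le> i"
  shows "block_parity J v (sym_diff U {i, Suc i})
    = (if v = rank J i \<or> v = rank J (Suc i) then - block_parity J v U else block_parity J v U)"
  unfolding block_parity_def using assms by (subst prod_sym_diff_pair) (auto simp: rank_Suc)

text \<open>
  Up to a factor, the alternating sign restricted to the sets that meet each of the blocks
  \<open>v \<in> V\<close> in an odd number of positions.
\<close>

definition block_weight :: "nat set \<Rightarrow> nat set \<Rightarrow> nat set \<Rightarrow> complex" where
  "block_weight J V U = alternating_sign U * (\<Prod>v\<in>V. 1 - block_parity J v U)"

lemma block_weight_toggle:
  assumes "finite U" "1 \<le> i" "i \<notin> J"
  shows "block_weight J V (sym_diff U {i, Suc i}) = - block_weight J V U"
  using assms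
  by (simp add: block_weight_def alternating_sign_toggle block_parity_toggle_same rank_Suc)

text \<open>The subtracted term is the same weight with block \<open>v\<close> reversed; in the
  lower bound this is the term that bounds.\<close>

lemma block_weight_insert:
  assumes "finite V" "v \<notin> V"
  shows "block_weight J (insert v V) U = block_weight J V U - block_parity J v U * block_weight J V U"
  using assms by (simp add: block_weight_def algebra_simps)

lemma block_weight_toggle_jump:
  assumes "finite U" "i \<in> J" "1 \<le> i" "\<And>v. v \<in> V \<Longrightarrow> rank J (Suc i) < v"
  shows "block_weight J V (sym_diff U {i, Suc i}) = - block_weight J V U"
proof -
  have "v \<noteq> rank J i \<and> v \<noteq> rank J (Suc i)" if "v \<in> V" for v
    using assms(4)[OF that] assms(2,3) by (auto simp: rank_Suc)
  then have "(\<Prod>v\<in>V. 1 - block_parity J v (sym_diff U {i, Suc i})) = (\<Prod>v\<in>V. 1 - block_parity J v U)"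
    using assms(1-3) by (intro prod.cong) (simp_all add: block_parity_toggle_jump)
  then show ?thesis
    using assms(1) by (simp add: block_weight_def alternating_sign_toggle)
qed

text \<open>A factor \<open>1 - block_parity J v U\<close> is nonzero only if \<open>U\<close> meets
  block \<open>v\<close> in an odd number of positions, hence at all, and distinct blocks need
  distinct elements. This turns a nonzero weight into a degree estimate.\<close>

lemma card_le_of_block_weight:
  assumes "finite U" "finite V" "block_weight J V U \<noteq> 0"
  shows "card V \<le> card U"
proof -
  have "V \<subseteq> rank J ` U"
  proof
    fix v assume "v \<in> V"
    then have "block_parity J v U \<noteq> 1"
      using assms by (auto simp: block_weight_def)
    then have "{p \<in> U. rank J p = v} \<noteq> {}"
      by (metis assms(1) block_parity_eq card.empty power_0)
    then show "v \<in> rank J ` U" by blast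
  qed
  then show ?thesis
    using assms(1) by (meson card_image_le card_mono finite_imageI le_trans)
qed

lemma block_weight_odd_blocks:
  assumes "finite U" "finite V"
  shows "block_weight J V U
    = (if \<forall>v\<in>V. odd (card {p \<in> U. rank J p = v}) then 2 ^ card V * alternating_sign U else 0)"
proof -
  have "(\<Prod>v\<in>V. 1 - block_parity J v U)
      = (\<Prod>v\<in>V. if odd (card {p \<in> U. rank J p = v}) then 2 else 0)"
    using assms(1) by (intro prod.cong) (auto simp: block_parity_eq)
  also have "\<dots> = (if \<forall>v\<in>V. odd (card {p \<in> U. rank J p = v}) then 2 ^ card V else 0)"
    using assms(2) by (auto intro!: prod.neutral)
  finally show ?thesis
    by (simp add: block_weight_def)
qed

lemma exists_odd_blocks:
  "\<exists>U\<subseteq>{1..Suc n}. \<forall>v\<in>{0..rank J (Suc n)}. odd (card {p \<in> U. rank J p = v})"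
proof -
  \<comment> \<open>The witness takes one position from each block, so that every count is
    1.\<close>
  have "\<forall>v\<in>{0..rank J (Suc n)}. \<exists>p\<in>{1..Suc n}. rank J p = v"
    unfolding rank_image[symmetric] by blast
  then obtain h where h: "\<And>v. v \<in> {0..rank J (Suc n)} \<Longrightarrow> h v \<in> {1..Suc n} \<and> rank J (h v) = v"
    by metis
  have "{p \<in> h ` {0..rank J (Suc n)}. rank J p = v} = {h v}" if "v \<in> {0..rank J (Suc n)}" for v
    using h that by auto
  then show ?thesis
    using h by (intro exI[of _ "h ` {0..rank J (Suc n)}"]) auto
qed

section \<open>Quotients by the closure of a relation\<close>

lemma equiv_closure_refl [simp]: "(x, x) \<in> equiv_closure r"
  by (simp add: equiv_closure_def)

lemma equiv_closure_step: "(x, y) \<in> r \<Longrightarrow> (x, y) \<in> equiv_closure r"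
  by (auto simp: equiv_closure_def)

lemma equiv_closure_sym: "(x, y) \<in> equiv_closure r \<Longrightarrow> (y, x) \<in> equiv_closure r"
  unfolding equiv_closure_def by (metis converse_Un converse_converse rtrancl_converseD sup_commute)

lemma equiv_closure_trans [trans]:
  "(x, y) \<in> equiv_closure r \<Longrightarrow> (y, z) \<in> equiv_closure r \<Longrightarrow> (x, z) \<in> equiv_closure r"
  unfolding equiv_closure_def by (rule rtrancl_trans)

lemma equiv_closure_invariant:
  assumes "(x, y) \<in> equiv_closure r" "\<And>a b. (a, b) \<in> r \<Longrightarrow> g a = g b"
  shows "g x = g y"
  using assms(1) unfolding equiv_closure_def by (induction rule: rtrancl_induct) (use assms(2) in auto)

text \<open>\<open>g\<close> acts as a complete invariant of the classes. The membership clause is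
  there because \<open>equiv_closure r\<close> relates points of the whole type, and a class must
  not leave \<open>A\<close>.\<close>

lemma quotient_equiv_closure:
  assumes inv: "\<And>a b. (a, b) \<in> r \<Longrightarrow> g a = g b \<and> (a \<in> A \<longleftrightarrow> b \<in> A)"
    and conn: "\<And>a b. a \<in> A \<Longrightarrow> b \<in> A \<Longrightarrow> g a = g b \<Longrightarrow> (a, b) \<in> equiv_closure r"
  shows "A // equiv_closure r = (\<lambda>v. {a \<in> A. g a = v}) ` g ` A"
proof -
  have "equiv_closure r `` {a} = {b \<in> A. g b = g a}" if a: "a \<in> A" for a
  proof (rule set_eqI)
    fix b
    have "g a = g b \<and> b \<in> A" if ab: "(a, b) \<in> equiv_closure r"
      using equiv_closure_invariant[OF ab, of g] equiv_closure_invariant[OF ab, of "\<lambda>x. x \<in> A"] inv a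
      by simp
    then show "b \<in> equiv_closure r `` {a} \<longleftrightarrow> b \<in> {b \<in> A. g b = g a}"
      using conn[OF a, of b] by (metis (mono_tags, lifting) Image_singleton_iff mem_Collect_eq)
  qed
  then show ?thesis
    unfolding quotient_def by (simp add: image_image UNION_singleton_eq_range)
qed

lemma card_quotient_equiv_closure:
  assumes "\<And>a b. (a, b) \<in> r \<Longrightarrow> g a = g b \<and> (a \<in> A \<longleftrightarrow> b \<in> A)"
    and "\<And>a b. a \<in> A \<Longrightarrow> b \<in> A \<Longrightarrow> g a = g b \<Longrightarrow> (a, b) \<in> equiv_closure r"
  shows "card (A // equiv_closure r) = card (g ` A)"
proof -
  have "inj_on (\<lambda>v. {a \<in> A. g a = v}) (g ` A)"
    by (rule inj_onI) blast
  then show ?thesis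
    using quotient_equiv_closure[of r g A] assms by (simp add: card_image)
qed

text \<open>The unoriented smoothing links the two bottom ends directly. The lemma serves to show
  that a set containing just one of them is not a circle.\<close>

lemma circle_through_unoriented_crossing:
  assumes "c < length (crossings D)" "c \<in> R \<longleftrightarrow> positive (crossings D ! c)" "Z \<in> circles D R"
  shows "bot_left (crossings D ! c) \<in> Z \<longleftrightarrow> bot_right (crossings D ! c) \<in> Z"
proof -
  have "(bot_left (crossings D ! c), bot_right (crossings D ! c)) \<in> circle_steps D R"
    using assms(1,2) by (auto simp: circle_steps_def smoothing_def)
  then have "(bot_left (crossings D ! c), bot_right (crossings D ! c))
      \<in> equiv_closure (circle_steps D R)"
    by (rule equiv_closure_step)
  with assms(3) show ?thesis
    unfolding circles_def quotient_def by (auto intro: equiv_closure_trans equiv_closure_sym)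
qed


section \<open>Closures of homogeneous braids\<close>

locale homogeneous_braid =
  fixes n :: nat and \<epsilon> :: "nat \<Rightarrow> int" and w :: braid_word
  assumes eps: "\<And>i. i \<in> {1..n} \<Longrightarrow> \<epsilon> i \<in> {- 1, 1}"
    and word: "set w \<subseteq> {(i, \<epsilon> i) | i. i \<in> {1..n}}"
    and knot: "is_knot (braid_closure (Suc n) w)"
begin

abbreviation D :: "(nat \<times> nat) diagram" where "D \<equiv> braid_closure (Suc n) w"

abbreviation Ro :: "nat set" where "Ro \<equiv> oriented_resolution D"

definition col :: "nat \<Rightarrow> nat" where "col t = fst (w ! t)"

definition strip :: "nat \<Rightarrow> (nat \<times> nat) set" where "strip p = {p} \<times> {0..length w}"

lemma letter: assumes "t < length w" shows "col t \<in> {1..n}" "w ! t = (col t, \<epsilon> (col t))"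
proof -
  have "w ! t \<in> {(i, \<epsilon> i) | i. i \<in> {1..n}}"
    using assms word nth_mem by blast
  then show "col t \<in> {1..n}" "w ! t = (col t, \<epsilon> (col t))"
    by (auto simp: col_def)
qed

lemma arcs_D: "arcs D = {1..Suc n} \<times> {0..length w}"
  by (simp add: braid_closure_def)

lemma finite_arcs [simp]: "finite (arcs D)"
  by (simp add: arcs_D)

lemma length_crossings [simp]: "length (crossings D) = length w"
  by (simp add: braid_closure_def)

lemma crossing_D:
  assumes "t < length w"
  shows "crossings D ! t = \<lparr>positive = (\<epsilon> (col t) = 1),
      bot_left = (col t, t), bot_right = (Suc (col t), t),
      top_left = (col t, Suc t), top_right = (Suc (col t), Suc t)\<rparr>"
  using assms letter(2)[OF assms] by (simp add: braid_closure_def braid_crossing_def)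

lemma set_crossings_D: "set (crossings D) = (\<lambda>t. crossings D ! t) ` {..<length w}"
  by (metis length_crossings lessThan_atLeast0 list.set_map map_nth set_upt)

lemma joins_D: "joins D = {((p, t), (p, Suc t)) | p t. p \<in> {1..Suc n} \<and> t < length w \<and>
      p \<noteq> col t \<and> p \<noteq> Suc (col t)} \<union> {((p, length w), (p, 0)) | p. p \<in> {1..Suc n}}"
  by (simp add: braid_closure_def col_def)

lemma Ro_iff: "c \<in> Ro \<longleftrightarrow> c < length w \<and> \<epsilon> (col c) \<noteq> 1"
  by (auto simp: oriented_resolution_def crossing_D)

lemma finite_Ro [simp]: "finite Ro"
  by (rule finite_subset[of _ "{..<length w}"]) (auto simp: Ro_iff)

text \<open>If no letter used column \<open>i\<close>, a strand at a position up to \<open>i\<close>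
  could never move beyond it, and the closure would have at least two components.\<close>

lemma column_used:
  assumes i: "i \<in> {1..n}"
  shows "\<exists>t<length w. col t = i"
proof (rule ccontr)
  assume unused: "\<not> ?thesis"
  have inv: "(fst a \<le> i) = (fst b \<le> i)" if "(a, b) \<in> strand_steps D" for a b
  proof -
    have "strand_steps D = joins D \<union> (\<Union>t<length w.
        {((col t, t), (Suc (col t), Suc t)), ((Suc (col t), t), (col t, Suc t))})"
      by (simp add: strand_steps_def set_crossings_D crossing_D)
    then consider "(a, b) \<in> joins D" | t where "t < length w"
        "(a, b) \<in> {((col t, t), (Suc (col t), Suc t)), ((Suc (col t), t), (col t, Suc t))}"
      using \<open>(a, b) \<in> strand_steps D\<close> by blast
    then show ?thesis
    proof cases
      case 1
      then show ?thesis by (auto simp: joins_D)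
    next
      case 2
      then have "col t \<noteq> i" using unused by blast
      with 2 show ?thesis by auto
    qed
  qed
  obtain Q where Q: "arcs D // equiv_closure (strand_steps D) = {Q}"
    using knot by (auto simp: is_knot_def link_components_def card_1_singleton_iff)
  have "(i, 0) \<in> arcs D" "(Suc i, 0) \<in> arcs D"
    using i by (auto simp: arcs_D)
  then have "equiv_closure (strand_steps D) `` {(i, 0)} = Q"
    "equiv_closure (strand_steps D) `` {(Suc i, 0)} = Q"
    using Q by (metis quotientI singletonD)+
  then have "((i, 0), (Suc i, 0)) \<in> equiv_closure (strand_steps D)"
    by (metis Image_singleton_iff equiv_closure_refl)
  from equiv_closure_invariant[OF this, of "\<lambda>a. fst a \<le> i"] inv show False
    by simp
qed

section \<open>Circles of the oriented resolution and of the resolutions one step below it\<close>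

lemma vertical_step:
  assumes "u < length w" "p \<in> {1..Suc n}"
    and "p = col u \<or> p = Suc (col u) \<Longrightarrow> u \<in> R \<longleftrightarrow> \<epsilon> (col u) \<noteq> 1"
  shows "((p, u), (p, Suc u)) \<in> circle_steps D R"
proof (cases "p = col u \<or> p = Suc (col u)")
  case True
  then have "((p, u), (p, Suc u)) \<in> smoothing (crossings D ! u) (u \<in> R)"
    using assms by (auto simp: smoothing_def crossing_D)
  then show ?thesis
    using assms(1) by (auto simp: circle_steps_def)
qed (use assms in \<open>auto simp: circle_steps_def joins_D\<close>)

text \<open>A circle that loses one of its vertical links stays connected through the closing strand.\<close>

lemma column_connected:
  assumes p: "p \<in> {1..Suc n}" and "t \<le> length w" "u \<le> length w"
    and steps: "\<And>u. u < length w \<Longrightarrow> u \<noteq> c \<Longrightarrow> ((p, u), (p, Suc u)) \<in> circle_steps D R"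
  shows "((p, t), (p, u)) \<in> equiv_closure (circle_steps D R)"
proof -
  let ?E = "equiv_closure (circle_steps D R)"
  have link: "((p, u), (p, Suc u)) \<in> ?E" if "u < length w" "u \<noteq> c" for u
    using steps[OF that] by (rule equiv_closure_step)
  have base: "((p, 0), (p, u)) \<in> ?E" if "u \<le> length w" for u
  proof (cases "u \<le> c")
    case True
    then show ?thesis
      using that
    proof (induction u)
      case (Suc u)
      then have "((p, 0), (p, u)) \<in> ?E" by simp
      also have "((p, u), (p, Suc u)) \<in> ?E"
        using Suc.prems by (intro link) auto
      finally show ?case .
    qed simp
  next
    case False
    have "((p, length w), (p, 0)) \<in> ?E"
      using p by (intro equiv_closure_step) (auto simp: circle_steps_def joins_D)
    then have "((p, 0), (p, length w)) \<in> ?E"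
      by (rule equiv_closure_sym)
    also from that False have "((p, length w), (p, u)) \<in> ?E"
    proof (induction u rule: inc_induct)
      case (step k)
      then have "((p, length w), (p, Suc k)) \<in> ?E" by simp
      also have "((p, Suc k), (p, k)) \<in> ?E"
        by (rule equiv_closure_sym, rule link) (use step in auto)
      finally show ?case .
    qed simp
    finally show ?thesis .
  qed
  show ?thesis
    by (rule equiv_closure_trans[OF equiv_closure_sym[OF base[OF assms(2)]] base[OF assms(3)]])
qed

lemma circle_steps_D_cases:
  assumes "(a, b) \<in> circle_steps D R"
  obtains (vertical) p u u' where "a = (p, u)" "b = (p, u')" "p \<in> {1..Suc n}"
      "u \<le> length w" "u' \<le> length w"
  | (horizontal) t u where "t < length w" "\<not> (t \<in> R \<longleftrightarrow> \<epsilon> (col t) \<noteq> 1)"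
      "a = (col t, u)" "b = (Suc (col t), u)" "u \<le> length w"
proof -
  consider "(a, b) \<in> joins D"
    | t where "t < length w" "(a, b) \<in> smoothing (crossings D ! t) (t \<in> R)"
    using assms unfolding circle_steps_def length_crossings by blast
  then show ?thesis
  proof cases
    case 1
    then show ?thesis
      unfolding joins_D by (elim UnE CollectE exE conjE Pair_inject; intro vertical) auto
  next
    case (2 t)
    show ?thesis
    proof (cases "t \<in> R \<longleftrightarrow> \<epsilon> (col t) \<noteq> 1")
      case True
      then have "(a, b) = ((col t, t), (col t, Suc t)) \<or>
          (a, b) = ((Suc (col t), t), (Suc (col t), Suc t))"
        using 2 by (auto simp: smoothing_def crossing_D)
      then show ?thesis
        using letter(1)[OF 2(1)] 2(1) by (elim disjE Pair_inject; intro vertical) auto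
    next
      case False
      then have "(a, b) = ((col t, t), (Suc (col t), t)) \<or>
          (a, b) = ((col t, Suc t), (Suc (col t), Suc t))"
        using 2 by (auto simp: smoothing_def crossing_D)
      then show ?thesis
        using False 2(1) by (elim disjE Pair_inject; intro horizontal) auto
    qed
  qed
qed

lemma strip_inject [simp]: "strip p = strip q \<longleftrightarrow> p = q"
proof
  assume "strip p = strip q"
  moreover have "(p, 0) \<in> strip p" by (simp add: strip_def)
  ultimately have "(p, 0) \<in> strip q" by simp
  then show "p = q" by (simp add: strip_def)
qed simp

lemma inj_strip: "inj_on strip A"
  by (simp add: inj_on_def)

lemma seifert_circles_D: "circles D Ro = strip ` {1..Suc n}"
proof -
  have inv: "fst a = fst b \<and> (a \<in> arcs D \<longleftrightarrow> b \<in> arcs D)" if "(a, b) \<in> circle_steps D Ro" for a b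
    using that by (cases rule: circle_steps_D_cases) (auto simp: Ro_iff arcs_D)
  have conn: "(a, b) \<in> equiv_closure (circle_steps D Ro)"
    if "a \<in> arcs D" "b \<in> arcs D" "fst a = fst b" for a b
  proof -
    obtain p t u where "a = (p, t)" "b = (p, u)" "p \<in> {1..Suc n}" "t \<le> length w" "u \<le> length w"
      using \<open>a \<in> arcs D\<close> \<open>b \<in> arcs D\<close> \<open>fst a = fst b\<close> by (cases a; cases b) (auto simp: arcs_D)
    then show ?thesis
      \<comment> \<open>Choosing \<open>c = length w\<close> excludes no height: at the oriented
        resolution every vertical link is present.\<close>
      by (auto intro!: column_connected[where c = "length w"] vertical_step simp: Ro_iff)
  qed
  have "circles D Ro = (\<lambda>v. {a \<in> arcs D. fst a = v}) ` fst ` arcs D"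
    unfolding circles_def by (rule quotient_equiv_closure[OF inv conn])
  also have "fst ` arcs D = {1..Suc n}"
    by (simp add: arcs_D fst_image_times)
  also have "(\<lambda>v. {a \<in> arcs D. fst a = v}) ` {1..Suc n} = strip ` {1..Suc n}"
    by (rule image_cong) (auto simp: arcs_D strip_def)
  finally show ?thesis .
qed

text \<open>Both \<open>i\<close> and \<open>Suc i\<close> name the merged circle, so the positions
  \<open>{1..Suc n}\<close> still index all circles.\<close>

definition merged_strip :: "nat \<Rightarrow> nat \<Rightarrow> (nat \<times> nat) set" where
  "merged_strip i p = (if p = i \<or> p = Suc i then strip i \<union> strip (Suc i) else strip p)"

text \<open>Each of the two strips at \<open>c\<close> loses one vertical link but stays connected
  around the closing strand, while the horizontal smoothing of \<open>c\<close> joins them into one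
  circle.\<close>

lemma circles_merged:
  assumes c: "c \<in> Ro"
  shows "circles D (Ro - {c}) = merged_strip (col c) ` {1..Suc n}"
proof -
  let ?i = "col c" and ?E = "equiv_closure (circle_steps D (Ro - {c}))"
  define g where "g a = (if fst a = Suc ?i then ?i else fst a)" for a :: "nat \<times> nat"
  have cL: "c < length w" using c by (simp add: Ro_iff)
  note i = letter(1)[OF cL]
  have inv: "g a = g b \<and> (a \<in> arcs D \<longleftrightarrow> b \<in> arcs D)"
    if "(a, b) \<in> circle_steps D (Ro - {c})" for a b
    using that
  proof (cases rule: circle_steps_D_cases)
    case (horizontal t u)
    then have "t = c" by (auto simp: Ro_iff)
    then show ?thesis
      using horizontal i by (auto simp: g_def arcs_D)
  qed (auto simp: g_def arcs_D)
  have column: "((p, t), (p, u)) \<in> ?E" if "p \<in> {1..Suc n}" "t \<le> length w" "u \<le> length w" for p t u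
    using that by (auto intro!: column_connected[where c = c] vertical_step simp: Ro_iff)
  have "((?i, c), (Suc ?i, c)) \<in> ?E"
    using c cL by (intro equiv_closure_step) (auto simp: circle_steps_def smoothing_def crossing_D Ro_iff
      intro!: bexI[of _ c])
  then have cross: "((?i, t), (Suc ?i, u)) \<in> ?E" if "t \<le> length w" "u \<le> length w" for t u
    using that i cL column[of ?i t c] column[of "Suc ?i" c u]
      equiv_closure_trans[OF equiv_closure_trans] by simp
  have conn: "(a, b) \<in> ?E" if "a \<in> arcs D" "b \<in> arcs D" "g a = g b" for a b
  proof -
    obtain p t q u where ab: "a = (p, t)" "b = (q, u)" by (cases a; cases b)
    then consider "p = q" | "p = ?i" "q = Suc ?i" | "q = ?i" "p = Suc ?i"
      using \<open>g a = g b\<close> by (auto simp: g_def split: if_splits)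
    then show ?thesis
      using ab that(1,2) by cases (auto simp: arcs_D column cross intro: equiv_closure_sym)
  qed
  have "circles D (Ro - {c}) = (\<lambda>v. {a \<in> arcs D. g a = v}) ` g ` arcs D"
    unfolding circles_def by (rule quotient_equiv_closure[OF inv conn])
  also have "\<dots> = (\<lambda>a. {b \<in> arcs D. g b = g a}) ` arcs D"
    by (simp add: image_image)
  also have "\<dots> = (\<lambda>a. merged_strip ?i (fst a)) ` arcs D"
    using i by (intro image_cong) (auto simp: merged_strip_def strip_def arcs_D g_def split: if_splits)
  also have "\<dots> = merged_strip ?i ` fst ` arcs D"
    by (simp add: image_image)
  also have "fst ` arcs D = {1..Suc n}"
    by (simp add: arcs_D fst_image_times)
  finally show ?thesis .
qed

subsection \<open>Labels of the Seifert circles\<close>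

text \<open>
  The regions of the oriented resolution are the strips between neighbouring circles, the number \<open>p\<close>
  lying between the circles \<open>p\<close> and \<open>p + 1\<close>.
\<close>

definition region :: "(nat \<times> nat) \<times> side \<Rightarrow> nat" where
  "region x = (case snd x of Left_Side \<Rightarrow> fst (fst x) - 1 | Right_Side \<Rightarrow> fst (fst x))"

text \<open>A path that avoids circle \<open>q\<close> cannot change whether its region number is at
  least \<open>q\<close>, and the unbounded region has number 0. Conversely, from the left of circle
  \<open>p\<close> one walks to infinity across the circles \<open>p - 1, ..., 1\<close>, all
  different from \<open>q\<close> when \<open>p <= q\<close>.\<close>

lemma separates_iff:
  assumes p: "p \<in> {1..Suc n}" and q: "q \<in> {1..Suc n}" and t: "t \<le> length w"
  shows "separates_from_infinity D (strip q) ((p, t), Left_Side) \<longleftrightarrow> q < p"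
proof -
  define r where "r = region_steps D \<union> {((e, Left_Side), (e, Right_Side)) | e. e \<in> arcs D - strip q}"
  have outer: "outer D = ((1, 0), Left_Side)"
    by (simp add: braid_closure_def)
  have inv: "(q \<le> region a) = (q \<le> region b)" if "(a, b) \<in> r" for a b
  proof -
    consider "(a, b) \<in> region_steps D" | e where "a = (e, Left_Side)" "b = (e, Right_Side)" "e \<in> arcs D - strip q"
      using \<open>(a, b) \<in> r\<close> unfolding r_def by blast
    then show ?thesis
    proof cases
      case 1
      then show ?thesis
        unfolding region_steps_def set_crossings_D joins_D
        by (elim UnE UN_E CollectE exE conjE imageE) (auto simp: crossing_D region_def split: side.splits)
    next
      case 2
      then show ?thesis by (cases e) (auto simp: region_def arcs_D strip_def)
    qed
  qed
  have vertical: "((p, t), s) \<in> equiv_closure r `` {((p, 0), s)}"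
    if "p \<in> {1..Suc n}" "t \<le> length w" for p t s
    using that(2)
  proof (induction t)
    case (Suc t)
    have "(((p, t), s), ((p, Suc t), s)) \<in> equiv_closure r"
    proof (cases "p = col t \<or> p = Suc (col t)")
      case True
      have "{(((col t, t), Left_Side), ((col t, Suc t), Left_Side)),
          (((Suc (col t), t), Right_Side), ((Suc (col t), Suc t), Right_Side)),
          (((col t, t), Right_Side), ((Suc (col t), t), Left_Side)),
          (((col t, Suc t), Right_Side), ((Suc (col t), Suc t), Left_Side)),
          (((col t, t), Right_Side), ((col t, Suc t), Right_Side))} \<subseteq> region_steps D"
        using Suc.prems unfolding region_steps_def set_crossings_D
        by (intro le_supI2 UN_upper[of t, THEN order_trans[rotated]]) (auto simp: crossing_D)
      then have e: "(((col t, t), Left_Side), ((col t, Suc t), Left_Side)) \<in> equiv_closure r"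
          "(((Suc (col t), t), Right_Side), ((Suc (col t), Suc t), Right_Side)) \<in> equiv_closure r"
          "(((col t, t), Right_Side), ((Suc (col t), t), Left_Side)) \<in> equiv_closure r"
          "(((col t, Suc t), Right_Side), ((Suc (col t), Suc t), Left_Side)) \<in> equiv_closure r"
          "(((col t, t), Right_Side), ((col t, Suc t), Right_Side)) \<in> equiv_closure r"
        by (auto simp: r_def intro!: equiv_closure_step)
      have "(((Suc (col t), t), Left_Side), ((Suc (col t), Suc t), Left_Side)) \<in> equiv_closure r"
        by (rule equiv_closure_trans[OF equiv_closure_trans[OF equiv_closure_sym[OF e(3)] e(5)] e(4)])
      then show ?thesis
        using True e by (cases s) auto
    next
      case False
      then show ?thesis
        using that Suc.prems by (intro equiv_closure_step) (auto simp: r_def region_steps_def joins_D)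
    qed
    then show ?case
      using Suc equiv_closure_trans[of "((p, 0), s)" "((p, t), s)" r "((p, Suc t), s)"] by simp
  qed simp
  have path: "(((p, t), Left_Side), ((1, 0), Left_Side)) \<in> equiv_closure r"
    if "1 \<le> p" "p \<le> q" "t \<le> length w" for p t
    using that
  proof (induction p arbitrary: t rule: dec_induct)
    case base
    then show ?case
      using vertical[of 1 t Left_Side] by (auto intro: equiv_closure_sym)
  next
    case (step p)
    \<comment> \<open>Different positions are linked by \<open>region_steps\<close> only at
      crossings, so a crossing in column \<open>p\<close> is needed to pass from the left of circle
      \<open>p + 1\<close> to the right of circle \<open>p\<close>.\<close>
    have "p \<in> {1..n}" using step q by auto
    then obtain t' where t': "t' < length w" "col t' = p"
      using column_used by blast
    have "(((p, t'), Right_Side), ((Suc p, t'), Left_Side)) \<in> r"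
      using t' unfolding r_def region_steps_def set_crossings_D
      by (auto simp: crossing_D intro!: bexI[of _ t'])
    then have 1: "(((Suc p, t'), Left_Side), ((p, t'), Right_Side)) \<in> equiv_closure r"
      by (rule equiv_closure_sym[OF equiv_closure_step])
    have "(((p, t'), Left_Side), ((p, t'), Right_Side)) \<in> r"
      using t' step.prems \<open>p \<in> {1..n}\<close> by (auto simp: r_def arcs_D strip_def)
    then have 2: "(((p, t'), Right_Side), ((p, t'), Left_Side)) \<in> equiv_closure r"
      by (rule equiv_closure_sym[OF equiv_closure_step])
    have "(((Suc p, 0), Left_Side), ((Suc p, t), Left_Side)) \<in> equiv_closure r"
      "(((Suc p, 0), Left_Side), ((Suc p, t'), Left_Side)) \<in> equiv_closure r"
      using vertical[of "Suc p"] t' step.prems \<open>p \<in> {1..n}\<close> by auto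
    then have 3: "(((Suc p, t), Left_Side), ((Suc p, t'), Left_Side)) \<in> equiv_closure r"
      by (rule equiv_closure_trans[OF equiv_closure_sym])
    have 4: "(((p, t'), Left_Side), ((1, 0), Left_Side)) \<in> equiv_closure r"
      using step t' by simp
    show ?case
      by (rule equiv_closure_trans[OF 3 equiv_closure_trans[OF 1 equiv_closure_trans[OF 2 4]]])
  qed
  show ?thesis
  proof
    assume "separates_from_infinity D (strip q) ((p, t), Left_Side)"
    then show "q < p"
      using path p t by (auto simp: separates_from_infinity_def outer r_def not_le[symmetric])
  next
    assume "q < p"
    then have "(q \<le> region ((p, t), Left_Side)) \<noteq> (q \<le> region (outer D))"
      using q by (auto simp: region_def outer)
    then show "separates_from_infinity D (strip q) ((p, t), Left_Side)"
      using equiv_closure_invariant[of "((p, t), Left_Side)" "outer D" r "\<lambda>a. q \<le> region a"] inv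
      unfolding separates_from_infinity_def r_def by blast
  qed
qed

text \<open>Region \<open>p - 1\<close> lies to the left of circle \<open>p\<close> and outside it,
  so the circle runs clockwise; the circles around it are \<open>1, ..., p - 1\<close>. Only the
  parity of \<open>p - 1\<close> remains.\<close>

lemma label_a_strip:
  assumes p: "p \<in> {1..Suc n}"
  shows "label_a D (strip p) \<longleftrightarrow> odd p"
proof -
  define sep where "sep C \<longleftrightarrow> (\<exists>e\<in>strip p. separates_from_infinity D C (e, Left_Side))" for C
  have iff: "sep (strip q) \<longleftrightarrow> q < p" if "q \<in> {1..Suc n}" for q
    using separates_iff[OF p that] unfolding sep_def by (auto simp: strip_def[of p])
  have "{C' \<in> seifert_circles D - {strip p}. sep C'} = strip ` {1..<p}"
    unfolding seifert_circles_D using p iff by auto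
  then have "nesting D (strip p) = p - 1"
    unfolding nesting_def sep_def by (simp add: card_image inj_strip)
  moreover have "\<not> counterclockwise D (strip p)"
    using iff[OF p] by (simp add: counterclockwise_def sep_def)
  ultimately show ?thesis
    using p by (cases p) (auto simp: label_a_def)
qed


section \<open>Positions of the factors \<open>1\<close> and \<open>x\<close>, and degrees at the
  oriented resolution\<close>

definition Pos :: "nat set" where "Pos = {i \<in> {1..n}. \<epsilon> i = 1}"

definition Neg :: "nat set" where "Neg = {i \<in> {1..n}. \<epsilon> i \<noteq> 1}"

definition x_positions :: "(nat \<times> nat) set set \<Rightarrow> nat set" where
  "x_positions S = {p \<in> {1..Suc n}. strip p \<in> S}"

definition one_positions :: "(nat \<times> nat) set set \<Rightarrow> nat set" where
  "one_positions S = {p \<in> {1..Suc n}. strip p \<notin> S}"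

lemma rank_Pos_Neg: "rank Pos (Suc n) + rank Neg (Suc n) = n"
proof -
  have "rank Pos (Suc n) + rank Neg (Suc n) = card (Pos \<union> Neg)"
    unfolding rank_def by (subst card_Un_disjoint[symmetric])
      (auto simp: Pos_def Neg_def intro!: arg_cong[where f = card])
  also have "Pos \<union> Neg = {1..n}" by (auto simp: Pos_def Neg_def)
  finally show ?thesis by simp
qed

lemma col_Neg: "c \<in> Ro \<Longrightarrow> col c \<in> Neg"
  using letter(1) by (auto simp: Ro_iff Neg_def)

lemma col_Pos: "c < length w \<Longrightarrow> c \<notin> Ro \<Longrightarrow> col c \<in> Pos"
  using letter(1) by (auto simp: Ro_iff Pos_def)

lemma finite_positions [simp]: "finite (x_positions S)" "finite (one_positions S)"
  by (simp_all add: x_positions_def one_positions_def)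

lemma positions_sym_diff:
  assumes "{p, q} \<subseteq> {1..Suc n}"
  shows "x_positions (sym_diff S {strip p, strip q}) = sym_diff (x_positions S) {p, q}"
    and "one_positions (sym_diff S {strip p, strip q}) = sym_diff (one_positions S) {p, q}"
  using assms by (auto simp: x_positions_def one_positions_def)

lemma card_positions:
  assumes "S \<subseteq> circles D Ro"
  shows "card S = card (x_positions S)" "card (circles D Ro - S) = card (one_positions S)"
    "card (x_positions S) + card (one_positions S) = Suc n"
proof -
  have "S = strip ` x_positions S" "circles D Ro - S = strip ` one_positions S"
    using assms by (auto simp: seifert_circles_D x_positions_def one_positions_def)
  then show "card S = card (x_positions S)" "card (circles D Ro - S) = card (one_positions S)"
    using card_image[OF inj_strip] by metis+
  have "x_positions S \<union> one_positions S = {1..Suc n}" "x_positions S \<inter> one_positions S = {}"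
    by (auto simp: x_positions_def one_positions_def)
  then show "card (x_positions S) + card (one_positions S) = Suc n"
    using card_Un_disjoint[of "x_positions S" "one_positions S"] by simp
qed

lemma n_minus_D: "n_minus D = card Ro"
  unfolding n_minus_def length_filter_conv_card oriented_resolution_def by simp

lemma degrees:
  assumes "S \<subseteq> circles D Ro"
  shows "hom_degree D (Ro, S) = 0"
    and "quantum_degree D (Ro, S) = int (Suc n) - 2 * int (card (x_positions S)) + writhe D"
  using card_positions[OF assms] by (simp_all add: n_minus_D writhe_def)

lemma Ro_subset: "Ro \<subseteq> {..<length (crossings D)}"
  by (auto simp: Ro_iff)

lemma state_Ro [simp]: "(Ro, S) \<in> states D \<longleftrightarrow> S \<subseteq> circles D Ro"
  using Ro_subset by (auto simp: states_def)

lemma not_circle: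
  assumes "c < length w" "c \<in> R \<longleftrightarrow> \<epsilon> (col c) = 1" "((col c, c) \<in> Z) \<noteq> ((Suc (col c), c) \<in> Z)"
  shows "Z \<notin> circles D R"
  using circle_through_unoriented_crossing[of c D R Z] assms by (auto simp: crossing_D)

text \<open>Each of the two strips contains exactly one bottom end of the crossing.\<close>

lemma strip_not_circle:
  assumes "c < length w" "c \<in> R \<longleftrightarrow> \<epsilon> (col c) = 1"
  shows "{strip (col c), strip (Suc (col c))} \<inter> circles D R = {}"
  using not_circle[OF assms] assms(1) by (auto simp: strip_def)

subsection \<open>Chains at the oriented resolution\<close>

text \<open>Chains are encoded by the positions of the factors \<open>1\<close>, because only these
  carry signs in Lee's generator.\<close>

definition oriented_chain :: "(nat set \<Rightarrow> complex) \<Rightarrow> (nat \<times> nat) chain" where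
  "oriented_chain F = (\<lambda>(R, S). if R = Ro \<and> S \<subseteq> circles D Ro then F (one_positions S) else 0)"

lemma supported_on_oriented_chain: "supported_on D Ro (oriented_chain F)"
  by (auto simp: supported_on_def oriented_chain_def split: if_splits)

lemma oriented_chain_Ro: "S \<subseteq> circles D Ro \<Longrightarrow> oriented_chain F (Ro, S) = F (one_positions S)"
  by (simp add: oriented_chain_def)

lemma canonical_generator_D: "canonical_generator D = oriented_chain alternating_sign"
proof -
  have "(\<Prod>C \<in> seifert_circles D - S. if label_a D C then 1 else - 1) = alternating_sign (one_positions S)"
    if "S \<subseteq> circles D Ro" for S
  proof -
    have "seifert_circles D - S = strip ` one_positions S"
      by (auto simp: seifert_circles_D one_positions_def)
    then have "(\<Prod>C \<in> seifert_circles D - S. if label_a D C then 1 else - 1 :: complex)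
        = (\<Prod>p\<in>one_positions S. if label_a D (strip p) then 1 else - 1)"
      by (simp add: prod.reindex[OF inj_strip])
    also have "\<dots> = alternating_sign (one_positions S)"
      unfolding alternating_sign_def
      by (rule prod.cong) (auto simp: one_positions_def label_a_strip uminus_power_if)
    finally show ?thesis .
  qed
  then show ?thesis
    by (auto simp: canonical_generator_def oriented_chain_def fun_eq_iff)
qed

text \<open>Every edge out of the oriented resolution changes a positive crossing and merges two
  neighbouring strips; under this condition all these merges kill the chain.\<close>

definition antisymmetric_at_Pos :: "(nat set \<Rightarrow> complex) \<Rightarrow> bool" where
  "antisymmetric_at_Pos F \<longleftrightarrow>
     (\<forall>j\<in>Pos. \<forall>U. finite U \<longrightarrow> F (sym_diff U {j, Suc j}) = - F U)"

lemma oriented_chain_cycle: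
  assumes "antisymmetric_at_Pos F"
  shows "lee_d D (oriented_chain F) = (\<lambda>_. 0)"
proof (rule ext, clarify)
  fix R' S'
  show "lee_d D (oriented_chain F) (R', S') = 0"
  proof (rule lee_d_antisymmetric[OF finite_arcs Ro_subset supported_on_oriented_chain])
    fix c assume "c < length (crossings D)" and c: "c \<notin> Ro" and R': "R' = insert c Ro"
    then have cL: "c < length w" by simp
    let ?A = "strip (col c)" and ?B = "strip (Suc (col c))"
    have AB: "{?A, ?B} \<subseteq> circles D Ro" "{col c, Suc (col c)} \<subseteq> {1..Suc n}"
      using letter(1)[OF cL] by (auto simp: seifert_circles_D)
    have "{?A, ?B} \<inter> circles D R' = {}"
      using c cL by (intro strip_not_circle) (auto simp: R' Ro_iff)
    then have sub: "{?A, ?B} \<subseteq> circles D Ro - circles D R'"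
      using AB(1) by blast
    have ne: "?A \<noteq> ?B" by simp
    have anti: "oriented_chain F (Ro, sym_diff S {?A, ?B}) = - oriented_chain F (Ro, S)"
      if "S \<subseteq> circles D Ro" for S
    proof -
      have "sym_diff S {?A, ?B} \<subseteq> circles D Ro" using that AB(1) by blast
      moreover have "F (sym_diff (one_positions S) {col c, Suc (col c)}) = - F (one_positions S)"
        using assms col_Pos[OF cL c] finite_positions(2) unfolding antisymmetric_at_Pos_def by blast
      ultimately show ?thesis
        using that by (simp only: oriented_chain_Ro positions_sym_diff[OF AB(2)])
    qed
    show "\<exists>A B. A \<noteq> B \<and> {A, B} \<subseteq> circles D Ro - circles D R' \<and>
        (\<forall>S \<subseteq> circles D Ro. oriented_chain F (Ro, sym_diff S {A, B}) = - oriented_chain F (Ro, S))"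
      by (rule exI[of _ ?A], rule exI[of _ ?B]) (intro conjI allI impI ne sub anti)
  qed
qed

section \<open>The split map into the oriented resolution\<close>

lemma mem_merged_strip:
  "(p, t) \<in> merged_strip i q \<longleftrightarrow> t \<le> length w \<and> (p = q \<or> {p, q} \<subseteq> {i, Suc i})"
  by (auto simp: merged_strip_def strip_def)

lemma merged_strip_inject:
  assumes "p \<noteq> Suc i" "q \<noteq> Suc i"
  shows "merged_strip i p = merged_strip i q \<longleftrightarrow> p = q"
proof
  assume "merged_strip i p = merged_strip i q"
  moreover have "(p, 0) \<in> merged_strip i p" by (simp add: mem_merged_strip)
  ultimately have "(p, 0) \<in> merged_strip i q" by simp
  then show "p = q" using assms by (auto simp: mem_merged_strip)
qed simp

text \<open>The terms of the coproduct of \<open>x\<close> have equal factors, those of the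
  coproduct of \<open>1\<close> different ones.\<close>

lemma lee_comult_factor:
  "(factor S B, factor S C) \<in> lee_comult (factor S' A) \<longleftrightarrow> (A \<in> S' \<longleftrightarrow> (B \<in> S) = (C \<in> S))"
  by (auto simp: factor_def)

lemma circles_merged_insert:
  assumes c: "c \<in> Ro"
  shows "circles D (Ro - {c}) = insert (merged_strip (col c) (col c))
    (strip ` ({1..Suc n} - {col c, Suc (col c)}))"
proof -
  let ?i = "col c" and ?M = "merged_strip (col c) (col c)"
  have "c < length w" using c by (simp add: Ro_iff)
  then have "{1..Suc n} = {?i, Suc ?i} \<union> ({1..Suc n} - {?i, Suc ?i})"
    using letter(1) by fastforce
  then have "circles D (Ro - {c}) = merged_strip ?i ` ({?i, Suc ?i} \<union> ({1..Suc n} - {?i, Suc ?i}))"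
    using circles_merged[OF c] by simp
  also have "\<dots> = {?M} \<union> merged_strip ?i ` ({1..Suc n} - {?i, Suc ?i})"
  proof -
    have "merged_strip ?i ` {?i, Suc ?i} = {?M}" by (simp add: merged_strip_def)
    then show ?thesis by (simp only: image_Un)
  qed
  also have "merged_strip ?i ` ({1..Suc n} - {?i, Suc ?i}) = strip ` ({1..Suc n} - {?i, Suc ?i})"
    by (rule image_cong) (auto simp: merged_strip_def)
  finally show ?thesis by simp
qed

lemma lee_edge_split:
  assumes c: "c \<in> Ro"
  shows "lee_edge D (Ro - {c}) S' Ro S \<longleftrightarrow>
    (\<forall>p\<in>{1..Suc n} - {col c, Suc (col c)}. strip p \<in> S \<longleftrightarrow> strip p \<in> S') \<and>
    (merged_strip (col c) (col c) \<in> S' \<longleftrightarrow> (strip (col c) \<in> S) = (strip (Suc (col c)) \<in> S))"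
proof -
  let ?i = "col c" and ?R = "Ro - {c}" and ?M = "merged_strip (col c) (col c)"
  have cL: "c < length w" using c by (simp add: Ro_iff)
  note i = letter(1)[OF cL]
  note R = circles_merged_insert[OF c]
  have M: "?M \<noteq> strip p" for p
  proof
    assume "?M = strip p"
    moreover have "(?i, 0) \<in> ?M" "(Suc ?i, 0) \<in> ?M" by (simp_all add: mem_merged_strip)
    ultimately show False by (auto simp: strip_def)
  qed
  have Ro: "circles D Ro = {strip ?i, strip (Suc ?i)} \<union> strip ` ({1..Suc n} - {?i, Suc ?i})"
    unfolding seifert_circles_D using i by auto
  have 1: "circles D ?R - circles D Ro = {?M}"
    unfolding R Ro using M by auto
  have 2: "circles D Ro - circles D ?R = {strip ?i, strip (Suc ?i)}"
    unfolding R Ro using M[symmetric] by auto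
  have 3: "circles D ?R \<inter> circles D Ro = strip ` ({1..Suc n} - {?i, Suc ?i})"
    unfolding R Ro using M by auto
  have 4: "factor S C = factor S' C \<longleftrightarrow> (C \<in> S \<longleftrightarrow> C \<in> S')" for C
    by (simp add: factor_def)
  \<comment> \<open>The two new circles come as an unordered pair; the coproduct is symmetric, so
    both orders give the same condition.\<close>
  have ex: "(\<exists>B C. B \<noteq> C \<and> {strip ?i, strip (Suc ?i)} = {B, C} \<and> Q B C) \<longleftrightarrow>
      Q (strip ?i) (strip (Suc ?i)) \<or> Q (strip (Suc ?i)) (strip ?i)" for Q
    by (metis doubleton_eq_iff strip_inject n_not_Suc_n)
  have "lee_edge D ?R S' Ro S \<longleftrightarrow>
      (\<forall>p\<in>{1..Suc n} - {?i, Suc ?i}. strip p \<in> S \<longleftrightarrow> strip p \<in> S') \<and>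
      (\<exists>B C. B \<noteq> C \<and> {strip ?i, strip (Suc ?i)} = {B, C} \<and> (?M \<in> S' \<longleftrightarrow> (B \<in> S) = (C \<in> S)))"
    unfolding lee_edge_def 1 2 3 4 lee_comult_factor by (auto simp: doubleton_eq_iff)
  also have "(\<exists>B C. B \<noteq> C \<and> {strip ?i, strip (Suc ?i)} = {B, C} \<and> (?M \<in> S' \<longleftrightarrow> (B \<in> S) = (C \<in> S)))
      \<longleftrightarrow> (?M \<in> S' \<longleftrightarrow> (strip ?i \<in> S) = (strip (Suc ?i) \<in> S))"
    unfolding ex by auto
  finally show ?thesis .
qed


text \<open>
  The positions of the factors \<open>1\<close> in one of the two terms of the comultiplication of \<open>S'\<close>,
  namely the term in which the right one of the two new circles carries \<open>x\<close>.
\<close>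

definition lift_positions :: "nat \<Rightarrow> (nat \<times> nat) set set \<Rightarrow> nat set" where
  "lift_positions i S' = {p \<in> {1..Suc n} - {Suc i}. merged_strip i p \<notin> S'}"

lemma lift_positions_sym_diff:
  assumes "{p, q} \<subseteq> {1..Suc n} - {Suc i}"
  shows "lift_positions i (sym_diff S' {merged_strip i p, merged_strip i q})
    = sym_diff (lift_positions i S') {p, q}"
proof (rule set_eqI)
  fix r
  show "r \<in> lift_positions i (sym_diff S' {merged_strip i p, merged_strip i q})
    \<longleftrightarrow> r \<in> sym_diff (lift_positions i S') {p, q}"
  proof (cases "r \<in> {1..Suc n} - {Suc i}")
    case True
    then have "merged_strip i r \<in> {merged_strip i p, merged_strip i q} \<longleftrightarrow> r \<in> {p, q}"
      using assms by (simp add: merged_strip_inject)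
    then show ?thesis
      using True unfolding lift_positions_def by blast
  next
    case False
    then show ?thesis
      using assms unfolding lift_positions_def by blast
  qed
qed

lemma finite_lift_positions [simp]: "finite (lift_positions i S')"
  by (simp add: lift_positions_def)

text \<open>Symmetry of \<open>F\<close> at \<open>col c\<close> gives the two terms of each
  coproduct equal coefficients, so the chain comes from the resolution in which the two strips at
  \<open>c\<close> are merged. Antisymmetry at the positive columns makes the preimage vanish along
  every other edge.\<close>

lemma oriented_chain_boundary:
  assumes c: "c \<in> Ro" and anti: "antisymmetric_at_Pos F"
    and sym: "\<And>U. finite U \<Longrightarrow> F (sym_diff U {col c, Suc (col c)}) = F U"
  shows "\<exists>b\<in>chains D (- 1). lee_d D b = oriented_chain F"
proof -
  define i R \<sigma> where "i = col c" and "R = Ro - {c}" and "\<sigma> = edge_sign D R Ro"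
  \<comment> \<open>\<open>F\<close> may be read off at either term of the coproduct;
    \<open>\<sigma>\<close> cancels the cube sign, being its own inverse.\<close>
  define b where "b = (\<lambda>(R', S'). if R' = R \<and> S' \<subseteq> circles D R then \<sigma> * F (lift_positions i S') else 0)"
  have cL: "c < length w" using c by (simp add: Ro_iff)
  have i: "i \<in> {1..n}" using letter(1)[OF cL] by (simp add: i_def)
  have R: "R \<subseteq> {..<length (crossings D)}" "c \<notin> R" "Ro = insert c R"
    using c Ro_subset by (auto simp: R_def)
  have "\<sigma> = (- 1) ^ card {k \<in> R. k < c}"
    unfolding \<sigma>_def R(3) using R(2) cL by (intro edge_sign_insert) auto
  then have \<sigma>: "\<sigma> * \<sigma> = 1"
    by (simp flip: power_add)
  have circ: "circles D R = merged_strip i ` {1..Suc n}"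
    using circles_merged[OF c] by (simp add: R_def i_def)
  have b: "b (R, S') = \<sigma> * F (lift_positions i S')" if "S' \<subseteq> circles D R" for S'
    using that by (simp add: b_def)
  have supp: "supported_on D R b"
    by (auto simp: supported_on_def b_def split: if_splits)
  have "b \<in> chains D (- 1)"
  proof -
    have "card Ro = Suc (card R)" using R by (metis card_insert_disjoint finite_Ro finite_insert)
    then show ?thesis
      using R(1) by (auto simp: chains_def b_def states_def n_minus_D split: if_splits)
  qed
  moreover have "lee_d D b = oriented_chain F"
  proof (rule ext, clarify)
    fix R' S
    consider "R' = Ro" "S \<subseteq> circles D Ro" | "R' = Ro" "\<not> S \<subseteq> circles D Ro" | "R' \<noteq> Ro" by blast
    then show "lee_d D b (R', S) = oriented_chain F (R', S)"
    proof cases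
      case 1
      \<comment> \<open>The only basis tensor whose image contains \<open>S\<close>: the merged
        circle carries \<open>x\<close> exactly when the two strips carry equal factors.\<close>
      define S0 where "S0 = {Z \<in> circles D R. if Z = merged_strip i i
        then (strip i \<in> S) = (strip (Suc i) \<in> S) else Z \<in> S}"
      have merged: "merged_strip i p = strip p" if "p \<noteq> i" "p \<noteq> Suc i" for p
        using that by (simp add: merged_strip_def)
      have circ': "circles D R = insert (merged_strip i i) (strip ` ({1..Suc n} - {i, Suc i}))"
        using circles_merged_insert[OF c] by (simp add: R_def i_def)
      have edge: "lee_edge D R S' Ro S \<longleftrightarrow> S' = S0" if S': "S' \<subseteq> circles D R" for S'
      proof -
        have in_S0: "strip p \<in> S0 \<longleftrightarrow> strip p \<in> S" if p: "p \<in> {1..Suc n} - {i, Suc i}" for p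
        proof -
          have "strip p \<in> circles D R" using p unfolding circ' by blast
          moreover have "strip p \<noteq> merged_strip i i"
            using merged_strip_inject[of p i i] merged[of p] p by auto
          ultimately show ?thesis by (simp add: S0_def)
        qed
        have M_S0: "merged_strip i i \<in> S0 \<longleftrightarrow> (strip i \<in> S) = (strip (Suc i) \<in> S)"
          using i circ' by (simp add: S0_def)
        have "S' = S0 \<longleftrightarrow> (\<forall>Z\<in>circles D R. Z \<in> S' \<longleftrightarrow> Z \<in> S0)"
          using S' by (auto simp: S0_def)
        also have "\<dots> \<longleftrightarrow> (merged_strip i i \<in> S' \<longleftrightarrow> merged_strip i i \<in> S0) \<and>
            (\<forall>p\<in>{1..Suc n} - {i, Suc i}. strip p \<in> S' \<longleftrightarrow> strip p \<in> S0)"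
          unfolding circ' using merged by simp
        also have "\<dots> \<longleftrightarrow> lee_edge D R S' Ro S"
          using in_S0 M_S0 unfolding R_def i_def lee_edge_split[OF c] by blast
        finally show ?thesis by blast
      qed
      have S0: "S0 \<in> Pow (circles D R)" by (auto simp: S0_def)
      have F_S0: "F (lift_positions i S0) = F (one_positions S)"
      proof -
        have lift: "p \<in> lift_positions i S0 \<longleftrightarrow>
            (if p = i then (strip i \<in> S) \<noteq> (strip (Suc i) \<in> S) else p \<noteq> Suc i \<and> p \<in> one_positions S)" for p
        proof (cases "p = i \<or> p = Suc i \<or> p \<notin> {1..Suc n}")
          case True
          then show ?thesis
            using i circ' by (auto simp: lift_positions_def one_positions_def S0_def)
        next
          case False
          then have "merged_strip i p \<noteq> merged_strip i i" "merged_strip i p \<in> circles D R"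
            using merged_strip_inject[of p i i] by (auto simp: circ)
          then show ?thesis
            using False merged[of p] by (auto simp: lift_positions_def one_positions_def S0_def)
        qed
        have one: "i \<in> one_positions S \<longleftrightarrow> strip i \<notin> S"
          "Suc i \<in> one_positions S \<longleftrightarrow> strip (Suc i) \<notin> S"
          using i by (auto simp: one_positions_def)
        show ?thesis
        \<comment> \<open>If the right strip carries \<open>x\<close>, then \<open>S\<close> is the
          term described by \<open>lift_positions\<close>; otherwise it is the other term, reached
          by toggling both strips, and \<open>sym\<close> gives the same value.\<close>
        proof (cases "strip (Suc i) \<in> S")
          case True
          then have "lift_positions i S0 = one_positions S"
            by (intro set_eqI) (auto simp: lift one)
          then show ?thesis by simp
        next
          case False
          then have "lift_positions i S0 = sym_diff (one_positions S) {i, Suc i}"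
            by (intro set_eqI) (auto simp: lift one)
          then show ?thesis
            using sym[of "one_positions S"] by (simp add: i_def)
        qed
      qed
      have "lee_d D b (Ro, S) = (\<Sum>S'\<in>Pow (circles D R). lee_coeff D (R, S') (Ro, S) * b (R, S'))"
        using 1 by (intro lee_d_supported_on finite_arcs R supp) simp
      also have "\<dots> = (\<Sum>S'\<in>Pow (circles D R). if S' = S0 then F (lift_positions i S') else 0)"
      proof (rule sum.cong)
        fix S' assume "S' \<in> Pow (circles D R)"
        then have S': "S' \<subseteq> circles D R" by simp
        have "\<sigma> * (\<sigma> * x) = x" for x
          using \<sigma> by (simp flip: mult.assoc)
        then show "lee_coeff D (R, S') (Ro, S) * b (R, S') = (if S' = S0 then F (lift_positions i S') else 0)"
          unfolding lee_coeff_eq b[OF S'] edge[OF S'] \<sigma>_def[symmetric] by simp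
      qed simp
      also have "\<dots> = F (lift_positions i S0)"
        using S0 by (simp add: finite_circles)
      finally show ?thesis
        using 1 F_S0 by (simp add: oriented_chain_Ro)
    next
      case 2
      then show ?thesis by (simp add: lee_d_def oriented_chain_def)
    next
      case 3
      have "lee_d D b (R', S) = 0"
      proof (rule lee_d_antisymmetric[OF finite_arcs R(1) supp])
        fix c' assume c': "c' < length (crossings D)" "c' \<notin> R" "R' = insert c' R"
        \<comment> \<open>Every negative crossing except \<open>c\<close> already lies in
          \<open>R\<close>, and \<open>c\<close> would lead to \<open>Ro\<close>; so
          \<open>c'\<close> is positive.\<close>
        then have c'L: "c' < length w" and "c' \<noteq> c" "c' \<notin> Ro" using 3 R by auto
        define j where "j = col c'"
        have j: "j \<in> Pos" "j \<in> {1..n}"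
          using col_Pos[OF c'L \<open>c' \<notin> Ro\<close>] letter(1)[OF c'L] by (auto simp: j_def)
        have "i \<in> Neg" using col_Neg[OF c] by (simp add: i_def)
        then have ij: "j \<noteq> i" using j by (auto simp: Pos_def Neg_def)
        \<comment> \<open>When \<open>j = Suc i\<close>, the left circle at the crossing is the
          merged one; its representative is \<open>i\<close>, since \<open>lift_positions\<close>
          excludes \<open>Suc i\<close>.\<close>
        define j' where "j' = (if j = Suc i then i else j)"
        let ?A = "merged_strip i j'" and ?B = "merged_strip i (Suc j)"
        have pos: "{j', Suc j} \<subseteq> {1..Suc n} - {Suc i}"
          using ij i j by (auto simp: j'_def)
        have "j' \<noteq> Suc j" by (auto simp: j'_def)
        then have ne: "?A \<noteq> ?B"
          using pos merged_strip_inject[of j' i "Suc j"] by auto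
        have unor: "c' \<in> R' \<longleftrightarrow> \<epsilon> (col c') = 1"
          using \<open>c' \<notin> Ro\<close> c'L c' by (auto simp: Ro_iff)
        have "?A \<notin> circles D R'" "?B \<notin> circles D R'"
          using ij c'L by (auto intro!: not_circle[OF c'L unor] simp: mem_merged_strip j'_def simp flip: j_def)
        then have sub: "{?A, ?B} \<subseteq> circles D R - circles D R'"
          using pos unfolding circ by blast
        have anti_j: "F (sym_diff U {j, Suc j}) = - F U" if "finite U" for U
          using anti j(1) that unfolding antisymmetric_at_Pos_def by blast
        have toggle: "F (sym_diff U {j', Suc j}) = - F U" if U: "finite U" for U
        proof (cases "j = Suc i")
          case True
          \<comment> \<open>The toggle is composed of \<open>{i, Suc i}\<close>, where
            \<open>F\<close> is symmetric, and \<open>{j, Suc j}\<close>, where it is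
            antisymmetric.\<close>
          then have "sym_diff U {j', Suc j} = sym_diff (sym_diff U {i, Suc i}) {j, Suc j}"
            by (auto simp: j'_def)
          then have "F (sym_diff U {j', Suc j}) = - F (sym_diff U {i, Suc i})"
            using anti_j[of "sym_diff U {i, Suc i}"] U by (simp only: finite_Un finite_Diff) simp
          then show ?thesis
            using sym[OF U] by (simp only: i_def)
        next
          case False
          then have "j' = j" by (simp add: j'_def)
          then show ?thesis
            using anti_j[OF U] by (simp only:)
        qed
        have "b (R, sym_diff S {?A, ?B}) = - b (R, S)" if "S \<subseteq> circles D R" for S
        proof -
          have "sym_diff S {?A, ?B} \<subseteq> circles D R" using that sub by blast
          then show ?thesis
            using that toggle[of "lift_positions i S"] by (simp only: b lift_positions_sym_diff[OF pos]) simp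
        qed
        then show "\<exists>A B. A \<noteq> B \<and> {A, B} \<subseteq> circles D R - circles D R' \<and>
            (\<forall>S \<subseteq> circles D R. b (R, sym_diff S {A, B}) = - b (R, S))"
          by (intro exI[of _ ?A] exI[of _ ?B] conjI allI impI ne sub)
      qed
      then show ?thesis using 3 by (simp add: oriented_chain_def)
    qed
  qed
  ultimately show ?thesis by blast
qed


subsection \<open>The two bounds\<close>

text \<open>Cut at the negative columns, the weight keeps only tensors with an odd number of factors
  \<open>1\<close> in each block from \<open>v\<close> on.\<close>

definition spread_chain :: "nat \<Rightarrow> (nat \<times> nat) chain" where
  "spread_chain v = oriented_chain (block_weight Neg {v..rank Neg (Suc n)})"

text \<open>The two chains differ by the chain of \<open>F\<close>. At the negative column in front
  of block \<open>v\<close> the alternating sign and the block parity both change, so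
  \<open>F\<close> is symmetric there; at positive columns only the alternating sign
  changes.\<close>

lemma homologous_spread_chain_step:
  assumes v: "1 \<le> v" "v \<le> rank Neg (Suc n)"
  shows "homologous D 0 (spread_chain (Suc v)) (spread_chain v)"
proof -
  let ?V = "{Suc v..rank Neg (Suc n)}"
  define F where "F U = - (block_parity Neg v U * block_weight Neg ?V U)" for U
  obtain i where i: "i \<in> Neg" "i \<in> {1..n}" "rank Neg (Suc i) = v" "rank Neg i = v - 1"
    using rank_jump[OF v] by blast
  then obtain c where c: "c < length w" "col c = i"
    using column_used by blast
  then have "c \<in> Ro" using i by (simp add: Ro_iff Neg_def)
  have "antisymmetric_at_Pos F"
    unfolding antisymmetric_at_Pos_def
  proof (intro ballI allI impI)
    fix j U assume "j \<in> Pos" and U: "finite (U :: nat set)"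
    then have j: "1 \<le> j" "j \<notin> Neg" by (auto simp: Pos_def Neg_def)
    then have r: "rank Neg j = rank Neg (Suc j)" by (simp add: rank_Suc)
    show "F (sym_diff U {j, Suc j}) = - F U"
      unfolding F_def block_weight_toggle[OF U j] block_parity_toggle_same[OF U r] by simp
  qed
  moreover have "F (sym_diff U {col c, Suc (col c)}) = F U" if U: "finite U" for U
  proof -
    have "block_weight Neg ?V (sym_diff U {i, Suc i}) = - block_weight Neg ?V U"
      using U i by (intro block_weight_toggle_jump) auto
    moreover have "block_parity Neg v (sym_diff U {i, Suc i}) = - block_parity Neg v U"
      using block_parity_toggle_jump[OF U i(1), of v] i by simp
    ultimately show ?thesis
      unfolding F_def c(2) by simp
  qed
  ultimately obtain b where b: "b \<in> chains D (- 1)" "lee_d D b = oriented_chain F"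
    using oriented_chain_boundary[OF \<open>c \<in> Ro\<close>] by blast
  have "{v..rank Neg (Suc n)} = insert v ?V" using v by auto
  then have "block_weight Neg {v..rank Neg (Suc n)} U = block_weight Neg ?V U + F U" for U
    by (simp add: block_weight_insert F_def)
  then have "spread_chain v = (\<lambda>T. spread_chain (Suc v) T + lee_d D b T)"
    unfolding spread_chain_def b(2) by (auto simp: oriented_chain_def fun_eq_iff)
  then show ?thesis
    unfolding homologous_def using b(1) by auto
qed

text \<open>The descent starts at the empty range of blocks, where the weight is the alternating
  sign alone, and ends at block 1, since block 0 has no negative column in front of it.\<close>

lemma homologous_spread_chain: "homologous D 0 (canonical_generator D) (spread_chain 1)"
proof -
  let ?m = "rank Neg (Suc n)"
  have "homologous D 0 (spread_chain (Suc ?m)) (spread_chain v)" if "1 \<le> v" "v \<le> Suc ?m" for v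
    using that(2,1)
  proof (induction v rule: inc_induct)
    case base
    show ?case by (rule homologous_refl)
  next
    case (step v)
    then show ?case
      using homologous_trans homologous_spread_chain_step[of v] by auto
  qed
  moreover have "spread_chain (Suc ?m) = canonical_generator D"
    by (simp add: spread_chain_def canonical_generator_D block_weight_def[abs_def])
  ultimately show ?thesis by (metis One_nat_def Suc_le_mono le0 order_refl)
qed

text \<open>In \<open>T^-(D)\<close> the edges join neighbouring strips across the negative columns,
  each of which contains a crossing. The components are therefore the blocks cut at the positive
  columns, numbered from 0 to \<open>rank Pos (Suc n)\<close>.\<close>

lemma U_bound_D: "U_bound D = int (Suc n) - 2 * int (Suc (rank Pos (Suc n))) + writhe D + 1"
proof -
  let ?r = "{(u, v). \<exists>(c, p, V)\<in>edges (remove_positive_edges (seifert_graph D)). u \<in> V \<and> v \<in> V}"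
  define g where "g C = rank Pos (the_inv_into {1..Suc n} strip C)" for C
  have g: "g (strip p) = rank Pos p" if "p \<in> {1..Suc n}" for p
    using that by (simp add: g_def the_inv_into_f_f inj_strip)
  have nodes: "nodes (seifert_graph D) = strip ` {1..Suc n}"
    by (simp add: seifert_graph_def seifert_circles_D)
  have ends: "{C \<in> seifert_circles D. bot_left (crossings D ! c) \<in> C \<or> bot_right (crossings D ! c) \<in> C}
      = {strip (col c), strip (Suc (col c))}" if "c < length w" for c
    using letter(1)[OF that] that unfolding seifert_circles_D by (auto simp: crossing_D strip_def)
  have edges: "?r = (\<Union>c\<in>Ro. {strip (col c), strip (Suc (col c))} \<times> {strip (col c), strip (Suc (col c))})"
  proof -
    have "edges (seifert_graph D) = (\<lambda>c. (c, positive (crossings D ! c), {C \<in> seifert_circles D.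
        bot_left (crossings D ! c) \<in> C \<or> bot_right (crossings D ! c) \<in> C})) ` {..<length w}"
      unfolding seifert_graph_def by (simp add: setcompr_eq_image lessThan_def)
    also have "\<dots> = (\<lambda>c. (c, \<epsilon> (col c) = 1, {strip (col c), strip (Suc (col c))})) ` {..<length w}"
    proof (rule image_cong[OF refl])
      fix c assume "c \<in> {..<length w}"
      then have c: "c < length w" by simp
      show "(c, positive (crossings D ! c), {C \<in> seifert_circles D.
          bot_left (crossings D ! c) \<in> C \<or> bot_right (crossings D ! c) \<in> C})
          = (c, \<epsilon> (col c) = 1, {strip (col c), strip (Suc (col c))})"
        unfolding ends[OF c] by (simp add: crossing_D[OF c])
    qed
    finally have "edges (remove_positive_edges (seifert_graph D))
        = (\<lambda>c. (c, False, {strip (col c), strip (Suc (col c))})) ` Ro"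
      by (auto simp: remove_positive_edges_def Ro_iff)
    then show ?thesis by auto
  qed
  have inv: "g a = g b \<and> (a \<in> strip ` {1..Suc n} \<longleftrightarrow> b \<in> strip ` {1..Suc n})" if ab: "(a, b) \<in> ?r" for a b
  proof -
    obtain c where c: "c \<in> Ro" and "a \<in> {strip (col c), strip (Suc (col c))}"
      "b \<in> {strip (col c), strip (Suc (col c))}"
      using ab unfolding edges by blast
    moreover have i: "col c \<in> {1..n}" "col c \<notin> Pos"
      using col_Neg[OF c] by (auto simp: Neg_def Pos_def)
    then have "g (strip (Suc (col c))) = g (strip (col c))"
      using g[of "col c"] g[of "Suc (col c)"] by (simp add: rank_Suc)
    ultimately show ?thesis
      using i by auto
  qed
  have conn: "(strip p, strip q) \<in> equiv_closure ?r"
    if "p \<le> q" "1 \<le> p" "q \<le> Suc n" "rank Pos p = rank Pos q" for p q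
    using that
  proof (induction q rule: dec_induct)
    case (step q)
    have "rank Pos p \<le> rank Pos q" "rank Pos q \<le> rank Pos (Suc q)"
      unfolding rank_def using step.hyps by (auto intro!: card_mono)
    then have "rank Pos p = rank Pos q" "q \<notin> Pos"
      using step by (auto simp: rank_Suc split: if_splits)
    moreover have "q \<in> {1..n}" using step by auto
    moreover from this obtain c where c: "c < length w" "col c = q"
      using column_used by blast
    ultimately have "c \<in> Ro" by (auto simp: Ro_iff Pos_def)
    then have "(strip q, strip (Suc q)) \<in> ?r"
      unfolding edges using c(2) by blast
    then have "(strip q, strip (Suc q)) \<in> equiv_closure ?r"
      by (rule equiv_closure_step)
    moreover have "(strip p, strip q) \<in> equiv_closure ?r"
      using step \<open>rank Pos p = rank Pos q\<close> by simp
    ultimately show ?case by (rule equiv_closure_trans[rotated])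
  qed simp
  have "card (strip ` {1..Suc n} // equiv_closure ?r) = card (g ` strip ` {1..Suc n})"
  proof (rule card_quotient_equiv_closure[OF inv])
    fix a b assume "a \<in> strip ` {1..Suc n}" "b \<in> strip ` {1..Suc n}" "g a = g b"
    then obtain p q where pq: "a = strip p" "b = strip q" "p \<in> {1..Suc n}" "q \<in> {1..Suc n}"
      "rank Pos p = rank Pos q"
      using g by auto
    show "(a, b) \<in> equiv_closure ?r"
    proof (cases "p \<le> q")
      case True
      then show ?thesis using conn pq by simp
    next
      case False
      then have "(b, a) \<in> equiv_closure ?r" using conn pq by simp
      then show ?thesis by (rule equiv_closure_sym)
    qed
  qed
  also have "g ` strip ` {1..Suc n} = rank Pos ` {1..Suc n}"
    unfolding image_image by (rule image_cong) (auto simp: g)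
  also have "card (rank Pos ` {1..Suc n}) = Suc (rank Pos (Suc n))"
    unfolding rank_image by simp
  finally have "card (graph_components (remove_positive_edges (seifert_graph D))) = Suc (rank Pos (Suc n))"
    unfolding graph_components_def by (simp add: remove_positive_edges_def nodes)
  then show ?thesis
    unfolding U_bound_def nodes by (simp add: card_image inj_strip)
qed

text \<open>Each of the \<open>rank Neg (Suc n)\<close> blocks from 1 on contributes a factor
  \<open>1\<close>, leaving at most \<open>rank Pos (Suc n) + 1\<close> factors \<open>x\<close>; at
  this maximum the degree is exactly \<open>U_bound D - 1\<close>.\<close>

lemma spread_chain_filtered: "spread_chain 1 \<in> filtered_chains D (U_bound D - 1) 0"
proof -
  have "(R, S) \<in> states D \<and> hom_degree D (R, S) = 0 \<and> U_bound D - 1 \<le> quantum_degree D (R, S)"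
    if "spread_chain 1 (R, S) \<noteq> 0" for R S
  proof -
    have RS: "R = Ro" "S \<subseteq> circles D Ro" "block_weight Neg {1..rank Neg (Suc n)} (one_positions S) \<noteq> 0"
      using that by (auto simp: spread_chain_def oriented_chain_def split: if_splits)
    then have "rank Neg (Suc n) \<le> card (one_positions S)"
      using card_le_of_block_weight[of "one_positions S" "{1..rank Neg (Suc n)}" Neg] by simp
    then have "card (x_positions S) \<le> Suc (rank Pos (Suc n))"
      using card_positions(3)[OF RS(2)] rank_Pos_Neg by linarith
    then have "U_bound D - 1 \<le> quantum_degree D (Ro, S)"
      unfolding degrees(2)[OF RS(2)] U_bound_D by simp
    with RS show ?thesis
      using degrees(1)[OF RS(2)] by (simp del: hom_degree.simps quantum_degree.simps)
  qed
  then show ?thesis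
    by (auto simp: filtered_chains_def chains_def simp del: hom_degree.simps quantum_degree.simps)
qed

lemma spread_chain_cycle: "lee_d D (spread_chain v) = (\<lambda>_. 0)"
  unfolding spread_chain_def
  by (rule oriented_chain_cycle)
    (auto simp: antisymmetric_at_Pos_def Pos_def Neg_def intro!: block_weight_toggle)

text \<open>Dual to the spread chains: the cuts are at positive columns, factors \<open>x\<close>
  are counted instead of \<open>1\<close>, and block 0 is constrained as well.\<close>

definition dual_weight :: "(nat \<times> nat) set set \<Rightarrow> complex" where
  "dual_weight S = block_weight Pos {0..rank Pos (Suc n)} (x_positions S)"

text \<open>Every edge into the oriented resolution changes a negative crossing, whose two strips
  lie in one block of the cut at \<open>Pos\<close>; toggling them only reverses the alternating
  sign.\<close>

lemma dual_weight_boundary: "(\<Sum>S\<in>Pow (circles D Ro). dual_weight S * lee_d D b (Ro, S)) = 0"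
proof (rule pairing_lee_d_antisymmetric[OF finite_arcs Ro_subset])
  fix c assume c: "c \<in> Ro"
  then have cL: "c < length w" by (simp add: Ro_iff)
  let ?A = "strip (col c)" and ?B = "strip (Suc (col c))"
  have AB: "{?A, ?B} \<subseteq> circles D Ro" "{col c, Suc (col c)} \<subseteq> {1..Suc n}"
    using letter(1)[OF cL] by (auto simp: seifert_circles_D)
  have "{?A, ?B} \<inter> circles D (Ro - {c}) = {}"
    using c by (intro strip_not_circle[OF cL]) (auto simp: Ro_iff)
  then have sub: "{?A, ?B} \<subseteq> circles D Ro - circles D (Ro - {c})"
    using AB(1) by blast
  have i: "1 \<le> col c" "col c \<notin> Pos"
    using col_Neg[OF c] by (auto simp: Pos_def Neg_def)
  have "dual_weight (sym_diff S {?A, ?B}) = - dual_weight S" for S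
    unfolding dual_weight_def positions_sym_diff(1)[OF AB(2)]
    by (rule block_weight_toggle[OF finite_positions(1) i])
  then show "\<exists>A B. A \<noteq> B \<and> {A, B} \<subseteq> circles D Ro - circles D (Ro - {c}) \<and>
      (\<forall>S \<subseteq> circles D Ro. dual_weight (sym_diff S {A, B}) = - dual_weight S)"
    using sub by (intro exI[of _ ?A] exI[of _ ?B] conjI allI impI) simp_all
qed

text \<open>The alternating signs of the \<open>x\<close>-positions and of the
  \<open>1\<close>-positions multiply to that of all positions, so the nonzero summands all equal
  \<open>C\<close> and cannot cancel.\<close>

lemma dual_weight_canonical_generator:
  "(\<Sum>S\<in>Pow (circles D Ro). dual_weight S * canonical_generator D (Ro, S)) \<noteq> 0"
proof -
  let ?V = "{0..rank Pos (Suc n)}"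
  define good where "good S \<longleftrightarrow> (\<forall>v\<in>?V. odd (card {p \<in> x_positions S. rank Pos p = v}))" for S
  define C where "C = 2 ^ card ?V * alternating_sign {1..Suc n}"
  have "dual_weight S * canonical_generator D (Ro, S) = (if good S then C else 0)"
    if "S \<in> Pow (circles D Ro)" for S
  proof -
    have "x_positions S \<union> one_positions S = {1..Suc n}" "x_positions S \<inter> one_positions S = {}"
      by (auto simp: x_positions_def one_positions_def)
    then have "alternating_sign (x_positions S) * alternating_sign (one_positions S) = alternating_sign {1..Suc n}"
      unfolding alternating_sign_def by (metis finite_positions prod.union_disjoint)
    then show ?thesis
      using that by (simp add: dual_weight_def canonical_generator_D oriented_chain_Ro block_weight_odd_blocks
        good_def C_def mult.assoc)
  qed
  then have "(\<Sum>S\<in>Pow (circles D Ro). dual_weight S * canonical_generator D (Ro, S))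
      = (\<Sum>S\<in>Pow (circles D Ro). if good S then C else 0)"
    by (rule sum.cong[OF refl])
  also have "\<dots> = of_nat (card {S \<in> Pow (circles D Ro). good S}) * C"
    by (subst sum.inter_filter[symmetric]) (simp_all add: finite_circles)
  also have "\<dots> \<noteq> 0"
  proof -
    obtain U where U: "U \<subseteq> {1..Suc n}" "\<forall>v\<in>?V. odd (card {p \<in> U. rank Pos p = v})"
      using exists_odd_blocks by blast
    then have "x_positions (strip ` U) = U"
      by (auto simp: x_positions_def)
    then have "good (strip ` U)"
      using U(2) by (simp only: good_def)
    moreover have "strip ` U \<subseteq> circles D Ro"
      unfolding seifert_circles_D using U(1) by (rule image_mono)
    ultimately have "strip ` U \<in> {S \<in> Pow (circles D Ro). good S}"
      by simp
    then have "card {S \<in> Pow (circles D Ro). good S} \<noteq> 0"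
      by (subst card_0_eq) (auto simp: finite_circles)
    moreover have "C \<noteq> 0"
      using alternating_sign_cases[of "{1..Suc n}"] by (auto simp: C_def)
    ultimately show ?thesis by simp
  qed
  finally show ?thesis .
qed

text \<open>\<open>z\<close> has the same pairing as the generator, so some tensor with a factor
  \<open>x\<close> in each of the \<open>rank Pos (Suc n) + 1\<close> blocks has a nonzero
  coefficient in \<open>z\<close>. Its degree bounds \<open>j\<close>.\<close>

lemma filtration_le_U_bound:
  assumes z: "z \<in> filtered_chains D j 0" and hom: "homologous D 0 z (canonical_generator D)"
  shows "j \<le> U_bound D - 1"
proof -
  obtain b where "canonical_generator D = (\<lambda>T. z T + lee_d D b T)"
    using hom by (auto simp: homologous_def)
  then have "(\<Sum>S\<in>Pow (circles D Ro). dual_weight S * z (Ro, S)) \<noteq> 0"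
    using dual_weight_canonical_generator dual_weight_boundary[of b]
    by (simp add: distrib_left sum.distrib)
  then obtain S where S: "S \<subseteq> circles D Ro" "dual_weight S \<noteq> 0" "z (Ro, S) \<noteq> 0"
    by (metis (no_types, lifting) PowD mult_eq_0_iff sum.neutral)
  then have "Suc (rank Pos (Suc n)) \<le> card (x_positions S)"
    using card_le_of_block_weight[of "x_positions S" "{0..rank Pos (Suc n)}" Pos]
    by (simp add: dual_weight_def)
  then have "quantum_degree D (Ro, S) \<le> U_bound D - 1"
    unfolding degrees(2)[OF S(1)] U_bound_D by simp
  moreover have "j \<le> quantum_degree D (Ro, S)"
    using z S(3) unfolding filtered_chains_def by blast
  ultimately show ?thesis by linarith
qed

lemma rasmussen_s_D: "rasmussen_s D = U_bound D"
proof -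
  have "s_min D = U_bound D - 1"
    unfolding s_min_def
  proof (rule Greatest_equality)
    have "homology_class D 0 (canonical_generator D) = homology_class D 0 (spread_chain 1)"
      using homologous_spread_chain by (simp add: homology_class_eq_iff)
    then show "homology_class D 0 (canonical_generator D) \<in> filtered_homology D (U_bound D - 1) 0"
      unfolding filtered_homology_def using spread_chain_filtered spread_chain_cycle by blast
  next
    fix j assume "homology_class D 0 (canonical_generator D) \<in> filtered_homology D j 0"
    then obtain z where "z \<in> filtered_chains D j 0"
      "homology_class D 0 z = homology_class D 0 (canonical_generator D)"
      unfolding filtered_homology_def by auto
    then show "j \<le> U_bound D - 1"
      using filtration_le_U_bound by (simp add: homology_class_eq_iff)
  qed
  then show ?thesis by (simp add: rasmussen_s_def)
qed

end

theorem proposition1p4: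
  fixes n :: nat and \<epsilon> :: "nat \<Rightarrow> int" and w :: braid_word
    and B :: "(nat \<times> nat) diagram"
  assumes "\<And>i. i \<in> {1..n} \<Longrightarrow> \<epsilon> i \<in> {- 1, 1}"
    and "set w \<subseteq> {(i, \<epsilon> i) | i. i \<in> {1..n}}"
    and "B = braid_closure (n + 1) w"
    and "is_knot B"
  shows "rasmussen_s B = U_bound B"
proof -
  interpret homogeneous_braid n \<epsilon> w
    by unfold_locales (use assms in auto)
  show ?thesis
    using rasmussen_s_D assms(3) by simp
qed

end
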